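(* Let $\mathbf n$ be a strictly increasing sequence of positive integers. The following hold: (i) If $\mathbf n$ has arbitrarily large additive gaps, there is a Banach space $\mathbb X$ with a Markushevich basis $\mathcal B$ that has the $\mathbf n$-UL property but is not unconditional for constant coefficients. (ii) If $\mathbf n$ has arbitrarily large quotient gaps, there is a Banach space $\mathbb X$ with a Schauder basis $\mathcal B$ that has the $\mathbf n$-UL property but is not unconditional for constant coefficients.
   Context: Banach spaces $\mathbb X$ are separable and infinite-dimensional over $\mathbb F=\mathbb R$ or $\mathbb C$, with dual $\mathbb X^*$. A basis of $\mathbb X$ is a sequence $\mathcal B=(\mathbf e_i)_{i\in\mathbb N}\subset\mathbb X$ with closed linear span $\mathbb X$, having a (unique) sequence of biorthogonal functionals $(\mathbf e_i^* )_{i\in\mathbb N}\subset\mathbb X^*$ ($\mathbf e_k^*(\mathbf e_i)=\delta_{k,i}$), with $0<\inf_i\min\{\|\mathbf e_i\|,\|\mathbf e_i^*\|\}\le\sup_i\max\{\|\mathbf e_i\|,\|\mathbf e_i^*\|\}<\infty$. It is a Markushevich basis if, in addition, $\mathbf e_i^*(x)=0$ for all $i$ implies $x=0$; it is a Schauder basis if moreover there is $\mathbf C>0$ with $\|\sum_{i=1}^m\mathbf e_i^*(x)\mathbf e_i\|\le\mathbf C\|x\|$ for all $x\in\mathbb X$, $m\in\mathbb N$. $\mathbf n=(n_k)_{k\in\mathbb N}$ is also regarded as a subset of $\mathbb N$. It has arbitrarily large additive gaps if $\limsup_k(n_{k+1}-n_k)=\infty$, and arbitrarily large quotient gaps if $\limsup_k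 n_{k+1}/n_k=\infty$. For a finite $A\subset\mathbb N$, $\Psi_A$ is the set of families $\varepsilon=(\varepsilon_n)_{n\in A}\subset\mathbb F$ with $|\varepsilon_n|=1$, $\mathbf 1_{\varepsilon A}=\sum_{n\in A}\varepsilon_n\mathbf e_n$ and $\mathbf 1_A=\sum_{n\in A}\mathbf e_n$. $\mathcal B$ has the $\mathbf n$-UL property if there are $\mathbf C_1,\mathbf C_2>0$ with $\frac1{\mathbf C_1}\min_{i\in A}|a_i|\,\|\mathbf 1_A\|\le\|\sum_{i\in A}a_i\mathbf e_i\|\le\mathbf C_2\max_{i\in A}|a_i|\,\|\mathbf 1_A\|$ for all $A\subset\mathbb N$ with $|A|\in\mathbf n$ and all scalars $(a_i)_{i\in A}$. $\mathcal B$ is unconditional for constant coefficients if there is $\mathbf C>0$ with $\|\mathbf 1_{\varepsilon A}\|\le\mathbf C\|\mathbf 1_{\varepsilon'A}\|$ for all finite $A\subset\mathbb N$ and all $\varepsilon,\varepsilon'\in\Psi_A$. *)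

theory Defs
  imports "HOL-Analysis.Analysis" "HOL-Library.Function_Algebras"
begin

text \<open>
  The library has no complex Banach spaces, and a statement ``there is a Banach space'' cannot
  quantify over types. A normed space is therefore a linear subspace \<open>X\<close> of some vector space
  given by \<open>smul\<close>, with a norm \<open>N\<close> that is only constrained on \<open>X\<close>.
\<close>

locale normed_space_on = vector_space smul
  for smul :: "'f::real_normed_field \<Rightarrow> 'v::ab_group_add \<Rightarrow> 'v" +
  fixes X :: "'v set" and N :: "'v \<Rightarrow> real"
  assumes subspace_X: "subspace X"
    and norm_zero_iff: "\<And>x. x \<in> X \<Longrightarrow> N x = 0 \<longleftrightarrow> x = 0"
    and norm_scale: "\<And>c x. x \<in> X \<Longrightarrow> N (smul c x) = norm c * N x"
    and norm_triangle: "\<And>x y. x \<in> X \<Longrightarrow> y \<in> X \<Longrightarrow> N (x + y) \<le> N x + N y"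
begin

lemma norm_nonneg:
  assumes "x \<in> X" shows "0 \<le> N x"
proof -
  have m: "smul (-1) x \<in> X" using assms subspace_X subspace_scale by blast
  have "N 0 = 0" using norm_zero_iff subspace_0[OF subspace_X] by blast
  moreover have "x + smul (-1) x = 0" by simp
  ultimately have "0 \<le> N x + N (smul (-1) x)" using norm_triangle[OF assms m] by simp
  also have "N (smul (-1) x) = N x" using norm_scale[OF assms, of "-1"] by simp
  finally show ?thesis by simp
qed

end

text \<open>The value off \<open>X\<close> is a dummy; it makes \<^locale>\<open>Metric_space\<close>, which constrains
  the distance on the whole type, applicable.\<close>

definition norm_dist :: "'v::ab_group_add set \<Rightarrow> ('v \<Rightarrow> real) \<Rightarrow> 'v \<Rightarrow> 'v \<Rightarrow> real" where
  "norm_dist X N x y = (if x \<in> X \<and> y \<in> X then N (x - y) else 0)"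

definition norm_topology :: "'v::ab_group_add set \<Rightarrow> ('v \<Rightarrow> real) \<Rightarrow> 'v topology" where
  "norm_topology X N = Metric_space.mtopology X (norm_dist X N)"

lemma (in normed_space_on) Metric_space_norm_dist: "Metric_space X (norm_dist X N)"
proof
  fix x y :: 'v
  show "0 \<le> norm_dist X N x y"
    by (simp add: norm_dist_def norm_nonneg subspace_X subspace_diff)
  show "norm_dist X N x y = norm_dist X N y x"
  proof (cases "x \<in> X \<and> y \<in> X")
    case True
    then have "N (smul (-1) (x - y)) = N (x - y)"
      using norm_scale[of "x - y" "-1"] by (simp add: subspace_X subspace_diff)
    moreover have "smul (-1) (x - y) = y - x" by simp
    ultimately show ?thesis using True by (simp add: norm_dist_def)
  qed (auto simp: norm_dist_def)
next
  fix x y assume "x \<in> X" "y \<in> X"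
  then show "norm_dist X N x y = 0 \<longleftrightarrow> x = y"
    by (simp add: norm_dist_def norm_zero_iff subspace_X subspace_diff)
next
  fix x y z assume "x \<in> X" "y \<in> X" "z \<in> X"
  then show "norm_dist X N x z \<le> norm_dist X N x y + norm_dist X N y z"
    using norm_triangle[of "x - y" "y - z"] by (simp add: norm_dist_def subspace_X subspace_diff)
qed

text \<open>Banach spaces are separable and infinite-dimensional by convention.\<close>

locale banach_space_on = normed_space_on smul X N
  for smul :: "'f::real_normed_field \<Rightarrow> 'v::ab_group_add \<Rightarrow> 'v"
    and X :: "'v set" and N :: "'v \<Rightarrow> real" +
  assumes complete: "Metric_space.mcomplete X (norm_dist X N)"
    and separable: "separable_space (norm_topology X N)"
    and infinite_dimensional: "\<not> (\<exists>B. finite B \<and> B \<subseteq> X \<and> span B = X)"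

text \<open>Functionals are total functions on \<open>'v\<close> of which only the values on \<open>X\<close> matter.\<close>

definition dual_space ::
  "('f::real_normed_field \<Rightarrow> 'v::ab_group_add \<Rightarrow> 'v) \<Rightarrow> 'v set \<Rightarrow> ('v \<Rightarrow> real) \<Rightarrow> ('v \<Rightarrow> 'f) set" where
  "dual_space smul X N = {f.
     (\<forall>x\<in>X. \<forall>y\<in>X. f (x + y) = f x + f y) \<and>
     (\<forall>c. \<forall>x\<in>X. f (smul c x) = c * f x) \<and>
     (\<exists>K. \<forall>x\<in>X. norm (f x) \<le> K * N x)}"

definition dual_norm :: "'v set \<Rightarrow> ('v \<Rightarrow> real) \<Rightarrow> ('v \<Rightarrow> 'f::real_normed_field) \<Rightarrow> real" where
  "dual_norm X N f = (SUP x\<in>{x \<in> X. N x \<le> 1}. norm (f x))"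

text \<open>
  Sequences are indexed from 0. The functionals \<open>f i\<close> biorthogonal to \<open>e\<close> are an explicit
  argument; density of the span of \<open>e\<close> determines them uniquely on \<open>X\<close>.
  Finiteness of the supremum is expressed by \<^const>\<open>bdd_above\<close>, since the supremum of an
  unbounded set of reals is unspecified.
\<close>

definition is_basis ::
  "('f::real_normed_field \<Rightarrow> 'v::ab_group_add \<Rightarrow> 'v) \<Rightarrow> 'v set \<Rightarrow> ('v \<Rightarrow> real)
    \<Rightarrow> (nat \<Rightarrow> 'v) \<Rightarrow> (nat \<Rightarrow> 'v \<Rightarrow> 'f) \<Rightarrow> bool" where
  "is_basis smul X N e f \<longleftrightarrow>
     range e \<subseteq> X \<and>
     norm_topology X N closure_of (module.span smul (range e)) = X \<and>
     range f \<subseteq> dual_space smul X N \<and>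
     (\<forall>k i. f k (e i) = (if k = i then 1 else 0)) \<and>
     0 < (INF i. min (N (e i)) (dual_norm X N (f i))) \<and>
     bdd_above (range (\<lambda>i. max (N (e i)) (dual_norm X N (f i))))"

definition markushevich_basis ::
  "('f::real_normed_field \<Rightarrow> 'v::ab_group_add \<Rightarrow> 'v) \<Rightarrow> 'v set \<Rightarrow> ('v \<Rightarrow> real)
    \<Rightarrow> (nat \<Rightarrow> 'v) \<Rightarrow> (nat \<Rightarrow> 'v \<Rightarrow> 'f) \<Rightarrow> bool" where
  "markushevich_basis smul X N e f \<longleftrightarrow>
     is_basis smul X N e f \<and> (\<forall>x\<in>X. (\<forall>i. f i x = 0) \<longrightarrow> x = 0)"

definition schauder_basis ::
  "('f::real_normed_field \<Rightarrow> 'v::ab_group_add \<Rightarrow> 'v) \<Rightarrow> 'v set \<Rightarrow> ('v \<Rightarrow> real)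
    \<Rightarrow> (nat \<Rightarrow> 'v) \<Rightarrow> (nat \<Rightarrow> 'v \<Rightarrow> 'f) \<Rightarrow> bool" where
  "schauder_basis smul X N e f \<longleftrightarrow>
     markushevich_basis smul X N e f \<and>
     (\<exists>C>0. \<forall>x\<in>X. \<forall>m. N (\<Sum>i<m. smul (f i x) (e i)) \<le> C * N x)"

definition additive_gaps :: "(nat \<Rightarrow> nat) \<Rightarrow> bool" where
  "additive_gaps n \<longleftrightarrow> limsup (\<lambda>k. ereal (real (n (Suc k)) - real (n k))) = \<infinity>"

definition quotient_gaps :: "(nat \<Rightarrow> nat) \<Rightarrow> bool" where
  "quotient_gaps n \<longleftrightarrow> limsup (\<lambda>k. ereal (real (n (Suc k)) / real (n k))) = \<infinity>"

definition UL_property ::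
  "('f::real_normed_field \<Rightarrow> 'v::ab_group_add \<Rightarrow> 'v) \<Rightarrow> ('v \<Rightarrow> real)
    \<Rightarrow> (nat \<Rightarrow> 'v) \<Rightarrow> (nat \<Rightarrow> nat) \<Rightarrow> bool" where
  "UL_property smul N e n \<longleftrightarrow>
     (\<exists>C1>0. \<exists>C2>0. \<forall>A. finite A \<and> card A \<in> range n \<longrightarrow> (\<forall>a :: nat \<Rightarrow> 'f.
        (1 / C1) * Min ((\<lambda>i. norm (a i)) ` A) * N (\<Sum>i\<in>A. e i) \<le> N (\<Sum>i\<in>A. smul (a i) (e i)) \<and>
        N (\<Sum>i\<in>A. smul (a i) (e i)) \<le> C2 * Max ((\<lambda>i. norm (a i)) ` A) * N (\<Sum>i\<in>A. e i)))"

definition unconditional_const_coeffs ::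
  "('f::real_normed_field \<Rightarrow> 'v::ab_group_add \<Rightarrow> 'v) \<Rightarrow> ('v \<Rightarrow> real) \<Rightarrow> (nat \<Rightarrow> 'v) \<Rightarrow> bool" where
  "unconditional_const_coeffs smul N e \<longleftrightarrow>
     (\<exists>C>0. \<forall>A. finite A \<longrightarrow> (\<forall>\<epsilon> \<epsilon>' :: nat \<Rightarrow> 'f.
        (\<forall>i\<in>A. norm (\<epsilon> i) = 1) \<and> (\<forall>i\<in>A. norm (\<epsilon>' i) = 1) \<longrightarrow>
        N (\<Sum>i\<in>A. smul (\<epsilon> i) (e i)) \<le> C * N (\<Sum>i\<in>A. smul (\<epsilon>' i) (e i))))"

text \<open>
  The vector space of all scalar sequences serves as the ambient space. This is no restriction:
  if \<open>f\<close> is the sequence of functionals of a Markushevich basis, \<open>x \<mapsto> (f i x)\<^sub>i\<close>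
  embeds the given space linearly into it.
\<close>

definition scale_seq :: "'f::real_normed_field \<Rightarrow> (nat \<Rightarrow> 'f) \<Rightarrow> (nat \<Rightarrow> 'f)" where
  "scale_seq c x = (\<lambda>i. c * x i)"

lemma vector_space_scale_seq: "vector_space scale_seq"
  by unfold_locales (auto simp: scale_seq_def fun_eq_iff algebra_simps)

end

theory Submission
  imports Defs
begin

text \<open>
  Every space below is normed by a set of finitely supported functionals: for
  \<open>\<Phi>\<close> containing the coordinate functionals and bounded by one in each coordinate, let
  \<open>N x\<close> be the supremum of \<open>\<bar>\<phi>(x)\<bar>\<close> over \<open>\<phi> \<in> \<Phi>\<close>, and let \<open>X\<close> be the completion of the
  finitely supported sequences. The unit vectors are then automatically a Markushevich basis,
  and a monotone Schauder basis if \<open>\<Phi>\<close> is closed under truncation. The UL property also becomes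
  a statement about \<open>\<Phi>\<close> alone: on a set \<open>A\<close> with \<open>\<bar>A\<bar> \<in> n\<close>, whatever mass \<open>\<Sum>\<^sub>A \<bar>\<phi> i\<bar>\<close> a functional
  carries must, up to a factor two, be realised against every choice of signs by some
  other functional in \<open>\<Phi>\<close> (\<open>UL_propertyI\<close>).

  To destroy unconditionality, take for each \<open>h\<close> in a set \<open>H\<close> a family \<open>F h\<close> that sees a large gap of
  \<open>n\<close>, and let \<open>B = {0, ..., M h - 1}\<close> be a set whose size lies in the middle of that gap.
  On \<open>B\<close> one of the constant and the alternating signs gets a value at least \<open>h\<close> from \<open>F h\<close>, the other
  only values at most 1. For a set with size in \<open>n\<close> the signs cannot matter in this
  way, since its size stays far from that of \<open>B\<close>.

  \<^item> Additive gap: \<open>g = h\<^sup>2\<close> and all \<open>n i\<close> are at least \<open>g\<close> away from \<open>M h\<close>. Functionals in \<open>F h\<close> have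
    entries at most \<open>1/h\<close>, at most \<open>2g\<close> nonzero entries, and kill \<open>1\<^sub>B\<close>. A set \<open>A\<close> with \<open>\<bar>A\<bar> \<in> n\<close>
    either misses \<open>g\<close> points of \<open>B\<close>, which can be used to compensate for any signs chosen on \<open>A\<close>,
    or has \<open>g\<close> points outside \<open>B\<close>, where the constraint is void. So \<open>F h\<close> always attains about
    \<open>min(\<bar>A\<bar>, g)/h\<close> (\<open>balanced_box_attains\<close>).
  \<^item> Quotient gap: no \<open>n i\<close> lies strictly between \<open>P\<close> and \<open>Q \<ge> h\<^sup>2 P\<close>, and \<open>M h = h P\<close>. To remain stable
    under truncation, \<open>F h\<close> contains \<open>1/P\<close> times the initial partial sums of length at most \<open>M h\<close>,
    which see \<open>1\<^sub>B\<close> but not the alternating signs. For \<open>\<bar>A\<bar> \<le> P\<close> they are dominated by sums of \<open>P\<close>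
    entries with weight \<open>1/P\<close>, for \<open>\<bar>A\<bar> \<ge> Q\<close> by sums of \<open>Q\<close> entries with weight \<open>h/Q\<close>; on \<open>B\<close> itself
    both are at most 1.

  The families do not interfere when \<open>H\<close> is sparse, \<open>M l \<le> h\<close> for \<open>l < h\<close> in \<open>H\<close>: on \<open>B\<close> a family \<open>F l\<close>
  with \<open>l < h\<close> attains at most \<open>2 l \<le> \<surd>(2 h)\<close>, and one with \<open>l > h\<close> at most \<open>M h / l \<le> 1\<close>. Hence the norms of
  the two sign vectors on \<open>B\<close> have a ratio of at least \<open>\<surd>(h/2)\<close>, which is unbounded.
\<close>

section \<open>Finitely supported functionals on sequences\<close>

definition pairing :: "(nat \<Rightarrow> 'f::real_normed_field) \<Rightarrow> (nat \<Rightarrow> 'f) \<Rightarrow> 'f" where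
  "pairing \<phi> x = (\<Sum>i | \<phi> i \<noteq> 0. \<phi> i * x i)"

definition unit_seq :: "nat \<Rightarrow> nat \<Rightarrow> 'f::real_normed_field" where
  "unit_seq i = (\<lambda>k. if k = i then 1 else 0)"

definition fin_supp :: "(nat \<Rightarrow> 'f::real_normed_field) set" where
  "fin_supp = {x. finite {i. x i \<noteq> 0}}"

lemma pairing_add: "pairing \<phi> (x + y) = pairing \<phi> x + pairing \<phi> y"
  by (simp add: pairing_def algebra_simps sum.distrib)

lemma pairing_diff: "pairing \<phi> (x - y) = pairing \<phi> x - pairing \<phi> y"
  by (simp add: pairing_def algebra_simps sum_subtractf)

lemma pairing_scale: "pairing \<phi> (scale_seq c x) = c * pairing \<phi> x"
  by (simp add: pairing_def scale_seq_def sum_distrib_left algebra_simps)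

lemma pairing_zero [simp]: "pairing \<phi> 0 = 0"
  by (simp add: pairing_def)

lemma pairing_unit_left [simp]: "pairing (unit_seq i) x = x i"
proof -
  have "{k. unit_seq i k \<noteq> (0::'a)} = {i}" by (auto simp: unit_seq_def)
  then show ?thesis by (simp add: pairing_def unit_seq_def)
qed

lemma pairing_eq_sum:
  assumes "finite {i. \<phi> i \<noteq> 0}" "finite S" "\<And>i. i \<notin> S \<Longrightarrow> x i = 0"
  shows "pairing \<phi> x = (\<Sum>i\<in>S. \<phi> i * x i)"
proof -
  have "pairing \<phi> x = (\<Sum>i\<in>{i. \<phi> i \<noteq> 0} \<union> S. \<phi> i * x i)"
    unfolding pairing_def using assms by (intro sum.mono_neutral_left) auto
  also have "\<dots> = (\<Sum>i\<in>S. \<phi> i * x i)"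
    using assms by (intro sum.mono_neutral_right) auto
  finally show ?thesis .
qed

lemma sum_unit_seq:
  assumes "finite A"
  shows "(\<Sum>i\<in>A. scale_seq (a i) (unit_seq i)) = (\<lambda>i. if i \<in> A then a i else 0)"
  using assms
  by (induction A rule: finite_induct)
     (auto simp: scale_seq_def unit_seq_def fun_eq_iff)

lemma fin_supp_iff: "x \<in> fin_supp \<longleftrightarrow> (\<exists>m. \<forall>i\<ge>m. x i = 0)"
proof
  assume "x \<in> fin_supp"
  then obtain m where "\<And>i. x i \<noteq> 0 \<Longrightarrow> i < m"
    unfolding fin_supp_def using finite_nat_set_iff_bounded by auto
  then show "\<exists>m. \<forall>i\<ge>m. x i = 0" by (meson linorder_not_less)
next
  assume "\<exists>m. \<forall>i\<ge>m. x i = 0"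
  then obtain m where "{i. x i \<noteq> 0} \<subseteq> {..<m}" by (auto simp: not_less[symmetric])
  then show "x \<in> fin_supp" unfolding fin_supp_def by (simp add: finite_subset)
qed

section \<open>The sequence space normed by a set of functionals\<close>

text \<open>
  The scalars are of class \<^class>\<open>euclidean_space\<close> because completeness of the scalar field
  makes the space complete, and a countable dense set of scalars makes it separable.
\<close>

locale norming_set =
  fixes \<Phi> :: "(nat \<Rightarrow> 'f::{real_normed_field,euclidean_space}) set"
  assumes finite_support: "\<phi> \<in> \<Phi> \<Longrightarrow> finite {i. \<phi> i \<noteq> 0}"
    and norm_le_one: "\<phi> \<in> \<Phi> \<Longrightarrow> norm (\<phi> i) \<le> 1"
    and unit_seq_in: "unit_seq i \<in> \<Phi>"
begin

definition N :: "(nat \<Rightarrow> 'f) \<Rightarrow> real" where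
  "N x = (SUP \<phi>\<in>\<Phi>. norm (pairing \<phi> x))"

text \<open>
  The closure of the finitely supported sequences. The condition bounds the functionals one by one
  instead of bounding \<open>N (x - y)\<close>, whose value is meaningless for an unbounded family; boundedness on
  \<open>X\<close> is then a consequence.
\<close>

definition X :: "(nat \<Rightarrow> 'f) set" where
  "X = {x. \<forall>r>0. \<exists>y\<in>fin_supp. \<forall>\<phi>\<in>\<Phi>. norm (pairing \<phi> (x - y)) \<le> r}"

lemma Phi_nonempty: "\<Phi> \<noteq> {}"
  using unit_seq_in by blast

lemma pairing_le_l1:
  assumes "\<phi> \<in> \<Phi>" "finite S" "\<And>i. i \<notin> S \<Longrightarrow> y i = 0"
  shows "norm (pairing \<phi> y) \<le> (\<Sum>i\<in>S. norm (y i))"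
proof -
  have "norm (pairing \<phi> y) = norm (\<Sum>i\<in>S. \<phi> i * y i)"
    using assms finite_support by (subst pairing_eq_sum[of _ S]) auto
  also have "\<dots> \<le> (\<Sum>i\<in>S. norm (y i))"
    using norm_le_one[OF assms(1)]
    by (intro sum_norm_le) (auto simp: norm_mult intro: mult_left_le_one_le)
  finally show ?thesis .
qed

lemma fin_supp_subset_X: "fin_supp \<subseteq> X"
proof
  fix x :: "nat \<Rightarrow> 'f"
  assume "x \<in> fin_supp"
  moreover have "norm (pairing \<phi> (x - x)) \<le> r" if "r > 0" for \<phi> and r :: real
    using that by simp
  ultimately show "x \<in> X" unfolding X_def by blast
qed

lemma X_iff: "x \<in> X \<longleftrightarrow> (\<forall>r>0. \<exists>y\<in>fin_supp. \<forall>\<phi>\<in>\<Phi>. norm (pairing \<phi> (x - y)) \<le> r)"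
  unfolding X_def by (rule mem_Collect_eq)

lemma X_approx:
  assumes "x \<in> X" "r > 0"
  obtains y where "y \<in> fin_supp" "\<And>\<phi>. \<phi> \<in> \<Phi> \<Longrightarrow> norm (pairing \<phi> (x - y)) \<le> r"
  using assms unfolding X_iff by blast

lemma bdd_above_pairing:
  assumes "x \<in> X" shows "bdd_above ((\<lambda>\<phi>. norm (pairing \<phi> x)) ` \<Phi>)"
proof -
  from assms obtain y where y: "y \<in> fin_supp" "\<And>\<phi>. \<phi> \<in> \<Phi> \<Longrightarrow> norm (pairing \<phi> (x - y)) \<le> 1"
    using X_approx[OF _ zero_less_one] by blast
  have "norm (pairing \<phi> x) \<le> 1 + (\<Sum>i | y i \<noteq> 0. norm (y i))" if "\<phi> \<in> \<Phi>" for \<phi>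
  proof -
    have "norm (pairing \<phi> x) \<le> norm (pairing \<phi> (x - y)) + norm (pairing \<phi> y)"
      unfolding pairing_diff by (simp add: norm_triangle_sub add.commute)
    moreover have "norm (pairing \<phi> y) \<le> (\<Sum>i | y i \<noteq> 0. norm (y i))"
      using y(1) by (intro pairing_le_l1 that) (auto simp: fin_supp_def)
    ultimately show ?thesis using y(2)[OF that] by linarith
  qed
  then show ?thesis by (auto simp: bdd_above_def)
qed

lemma pairing_le_N: "x \<in> X \<Longrightarrow> \<phi> \<in> \<Phi> \<Longrightarrow> norm (pairing \<phi> x) \<le> N x"
  unfolding N_def by (rule cSUP_upper[OF _ bdd_above_pairing])

lemma N_leI: "(\<And>\<phi>. \<phi> \<in> \<Phi> \<Longrightarrow> norm (pairing \<phi> x) \<le> c) \<Longrightarrow> N x \<le> c"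
  unfolding N_def by (rule cSUP_least[OF Phi_nonempty])

lemma coord_le_N: "x \<in> X \<Longrightarrow> norm (x i) \<le> N x"
  using pairing_le_N[OF _ unit_seq_in[of i]] by simp

lemma unit_seq_in_X: "unit_seq i \<in> X"
proof -
  have "unit_seq i \<in> fin_supp" by (auto simp: fin_supp_def unit_seq_def)
  then show ?thesis using fin_supp_subset_X by blast
qed

lemma X_add: "x \<in> X \<Longrightarrow> y \<in> X \<Longrightarrow> x + y \<in> X"
proof -
  assume x: "x \<in> X" and y: "y \<in> X"
  show "x + y \<in> X" unfolding X_iff
  proof (intro allI impI)
    fix r :: real assume "r > 0"
    then have r2: "r / 2 > 0" by simp
    obtain u where u: "u \<in> fin_supp" "\<And>\<phi>. \<phi> \<in> \<Phi> \<Longrightarrow> norm (pairing \<phi> (x - u)) \<le> r / 2"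
      using X_approx[OF x r2] by blast
    obtain v where v: "v \<in> fin_supp" "\<And>\<phi>. \<phi> \<in> \<Phi> \<Longrightarrow> norm (pairing \<phi> (y - v)) \<le> r / 2"
      using X_approx[OF y r2] by blast
    have "u + v \<in> fin_supp"
      using u(1) v(1) unfolding fin_supp_def
      by (auto intro: finite_subset[of _ "{i. u i \<noteq> 0} \<union> {i. v i \<noteq> 0}"])
    moreover have "norm (pairing \<phi> (x + y - (u + v))) \<le> r" if "\<phi> \<in> \<Phi>" for \<phi>
    proof -
      have "pairing \<phi> (x + y - (u + v)) = pairing \<phi> (x - u) + pairing \<phi> (y - v)"
        by (simp add: pairing_diff pairing_add)
      then have "norm (pairing \<phi> (x + y - (u + v))) \<le> norm (pairing \<phi> (x - u)) + norm (pairing \<phi> (y - v))"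
        by (simp add: norm_triangle_ineq)
      then show ?thesis using u(2)[OF that] v(2)[OF that] by linarith
    qed
    ultimately show "\<exists>w\<in>fin_supp. \<forall>\<phi>\<in>\<Phi>. norm (pairing \<phi> (x + y - w)) \<le> r" by blast
  qed
qed

lemma X_scale: "x \<in> X \<Longrightarrow> scale_seq c x \<in> X"
proof -
  assume x: "x \<in> X"
  show "scale_seq c x \<in> X" unfolding X_iff
  proof (intro allI impI)
    fix r :: real assume r: "r > 0"
    have p: "norm c + 1 > 0" by (simp add: add_nonneg_pos)
    have "r / (norm c + 1) > 0" using r p by simp
    then obtain u where u: "u \<in> fin_supp" "\<And>\<phi>. \<phi> \<in> \<Phi> \<Longrightarrow> norm (pairing \<phi> (x - u)) \<le> r / (norm c + 1)"
      using X_approx[OF x] by blast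
    have "scale_seq c u \<in> fin_supp"
      using u(1) unfolding fin_supp_def scale_seq_def
      by (auto intro: finite_subset[of _ "{i. u i \<noteq> 0}"])
    moreover have "norm (pairing \<phi> (scale_seq c x - scale_seq c u)) \<le> r" if "\<phi> \<in> \<Phi>" for \<phi>
    proof -
      have "pairing \<phi> (scale_seq c x - scale_seq c u) = c * pairing \<phi> (x - u)"
        by (simp add: pairing_diff pairing_scale algebra_simps)
      then have "norm (pairing \<phi> (scale_seq c x - scale_seq c u)) \<le> norm c * (r / (norm c + 1))"
        using u(2)[OF that] by (simp add: norm_mult mult_left_mono del: times_divide_eq_right)
      also have "\<dots> \<le> r" using r p by (simp add: pos_divide_le_eq algebra_simps)
      finally show ?thesis .
    qed
    ultimately show "\<exists>w\<in>fin_supp. \<forall>\<phi>\<in>\<Phi>. norm (pairing \<phi> (scale_seq c x - w)) \<le> r" by blast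
  qed
qed

interpretation vs: vector_space "scale_seq :: 'f \<Rightarrow> _"
  by (rule vector_space_scale_seq)

lemma subspace_X: "vs.subspace X"
  unfolding vs.subspace_def using X_add X_scale fin_supp_subset_X by (auto simp: fin_supp_def)

lemma normed_space: "normed_space_on scale_seq X N"
proof unfold_locales
  show "vs.subspace X" by (rule subspace_X)
  fix x assume x: "x \<in> X"
  show "(N x = 0) = (x = 0)"
  proof
    assume "N x = 0"
    then have "x i = 0" for i using coord_le_N[OF x, of i] by simp
    then show "x = 0" by (simp add: fun_eq_iff)
  next
    assume "x = 0"
    then show "N x = 0" by (simp add: N_def Phi_nonempty)
  qed
  show "N (scale_seq c x) = norm c * N x" for c
  proof (rule antisym)
    show "N (scale_seq c x) \<le> norm c * N x"
      by (rule N_leI) (simp add: pairing_scale norm_mult mult_left_mono pairing_le_N[OF x])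
    show "norm c * N x \<le> N (scale_seq c x)"
    proof (cases "c = 0")
      case True
      then show ?thesis using coord_le_N[OF X_scale[OF x, of c], of 0] by simp
    next
      case False
      have "N x \<le> N (scale_seq c x) / norm c"
      proof (rule N_leI)
        fix \<phi> assume "\<phi> \<in> \<Phi>"
        then have "norm (pairing \<phi> (scale_seq c x)) \<le> N (scale_seq c x)"
          by (intro pairing_le_N X_scale x)
        then show "norm (pairing \<phi> x) \<le> N (scale_seq c x) / norm c"
          using False by (simp add: pairing_scale norm_mult field_simps)
      qed
      then show ?thesis using False by (simp add: field_simps)
    qed
  qed
  fix y assume y: "y \<in> X"
  show "N (x + y) \<le> N x + N y"
  proof (rule N_leI)
    fix \<phi> assume "\<phi> \<in> \<Phi>"
    then show "norm (pairing \<phi> (x + y)) \<le> N x + N y"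
      unfolding pairing_add using pairing_le_N[OF x] pairing_le_N[OF y]
      by (intro norm_triangle_le add_mono)
  qed
qed

interpretation ns: normed_space_on scale_seq X N
  by (rule normed_space)

interpretation ms: Metric_space X "norm_dist X N"
  by (rule ns.Metric_space_norm_dist)

lemma X_diff: "x \<in> X \<Longrightarrow> y \<in> X \<Longrightarrow> x - y \<in> X"
  by (simp add: subspace_X vs.subspace_diff)

lemma norm_dist_eq: "x \<in> X \<Longrightarrow> y \<in> X \<Longrightarrow> norm_dist X N x y = N (x - y)"
  by (simp add: norm_dist_def)

lemma N_approx:
  assumes "x \<in> X" "r > 0"
  obtains y where "y \<in> fin_supp" "N (x - y) < r"
proof -
  obtain y where y: "y \<in> fin_supp" "\<And>\<phi>. \<phi> \<in> \<Phi> \<Longrightarrow> norm (pairing \<phi> (x - y)) \<le> r / 2"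
    using X_approx[OF assms(1) half_gt_zero[OF assms(2)]] by blast
  have "N (x - y) \<le> r / 2" by (rule N_leI[OF y(2)])
  then have "N (x - y) < r" using assms(2) by linarith
  then show ?thesis using that y(1) by blast
qed

lemma closure_of_eqI:
  assumes "D \<subseteq> X" "\<And>y r. y \<in> fin_supp \<Longrightarrow> r > 0 \<Longrightarrow> \<exists>d\<in>D. N (y - d) < r"
  shows "norm_topology X N closure_of D = X"
proof -
  have "\<exists>d\<in>D. d \<in> ms.mball x r" if x: "x \<in> X" and r: "r > 0" for x r
  proof -
    obtain y where y: "y \<in> fin_supp" "N (x - y) < r / 2"
      using N_approx[OF x, of "r / 2"] r by auto
    obtain d where d: "d \<in> D" "N (y - d) < r / 2" using assms(2)[OF y(1), of "r/2"] r by auto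
    have X: "y \<in> X" "d \<in> X" using y d assms(1) fin_supp_subset_X by auto
    have "N (x - d) \<le> N (x - y) + N (y - d)"
      using ns.norm_triangle[of "x - y" "y - d"] X x by (simp add: X_diff)
    then have "N (x - d) < r" using y d by simp
    then show ?thesis using d X x r by (auto simp: norm_dist_eq)
  qed
  then show ?thesis unfolding norm_topology_def ms.metric_closure_of by auto
qed

text \<open>
  Coordinates are dominated by the norm, so a Cauchy sequence converges coordinatewise. Each functional
  has finite support, hence is continuous for coordinatewise convergence, and the Cauchy estimate
  passes to the limit uniformly over \<open>\<Phi>\<close>.
\<close>

lemma mcomplete: "ms.mcomplete"
  unfolding ms.mcomplete_def
proof (intro allI impI)
  fix \<sigma> assume C: "ms.MCauchy \<sigma>"
  then have \<sigma>X: "\<sigma> k \<in> X" for k unfolding ms.MCauchy_def by auto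
  have cauchy: "\<exists>K. \<forall>k\<ge>K. \<forall>l\<ge>K. N (\<sigma> k - \<sigma> l) < r" if "r > 0" for r
    using C that \<sigma>X unfolding ms.MCauchy_def by (simp add: norm_dist_eq)
  have "convergent (\<lambda>k. \<sigma> k i)" for i
  proof (rule Cauchy_convergent)
    show "Cauchy (\<lambda>k. \<sigma> k i)"
      unfolding Cauchy_def
    proof (intro allI impI)
      fix r :: real assume "r > 0"
      then obtain K where K: "\<forall>k\<ge>K. \<forall>l\<ge>K. N (\<sigma> k - \<sigma> l) < r" using cauchy by blast
      have "dist (\<sigma> k i) (\<sigma> l i) < r" if "k \<ge> K" "l \<ge> K" for k l
      proof -
        have "norm ((\<sigma> k - \<sigma> l) i) \<le> N (\<sigma> k - \<sigma> l)" by (intro coord_le_N X_diff \<sigma>X)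
        then show ?thesis using K that by (auto simp: dist_norm intro: le_less_trans)
      qed
      then show "\<exists>K. \<forall>k\<ge>K. \<forall>l\<ge>K. dist (\<sigma> k i) (\<sigma> l i) < r" by blast
    qed
  qed
  then obtain x where x: "\<And>i. (\<lambda>k. \<sigma> k i) \<longlonglongrightarrow> x i"
    unfolding convergent_def by metis
  have unif: "\<exists>K. \<forall>k\<ge>K. \<forall>\<phi>\<in>\<Phi>. norm (pairing \<phi> (x - \<sigma> k)) \<le> r" if r: "r > 0" for r
  proof -
    obtain K where K: "\<forall>k\<ge>K. \<forall>l\<ge>K. N (\<sigma> k - \<sigma> l) < r" using cauchy r by blast
    have "norm (pairing \<phi> (x - \<sigma> k)) \<le> r" if k: "k \<ge> K" and \<phi>: "\<phi> \<in> \<Phi>" for k \<phi>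
    proof (rule LIMSEQ_le_const2)
      show "(\<lambda>l. norm (pairing \<phi> (\<sigma> l - \<sigma> k))) \<longlonglongrightarrow> norm (pairing \<phi> (x - \<sigma> k))"
        unfolding pairing_def by (auto intro!: tendsto_intros x)
      show "\<exists>L. \<forall>l\<ge>L. norm (pairing \<phi> (\<sigma> l - \<sigma> k)) \<le> r"
        using K k pairing_le_N[OF X_diff[OF \<sigma>X \<sigma>X] \<phi>] by (meson le_less_trans less_imp_le)
    qed
    then show ?thesis by blast
  qed
  have "x \<in> X" unfolding X_iff
  proof (intro allI impI)
    fix r :: real assume "r > 0"
    then obtain k where k: "\<forall>\<phi>\<in>\<Phi>. norm (pairing \<phi> (x - \<sigma> k)) \<le> r / 2"
      using unif[OF half_gt_zero[OF \<open>r > 0\<close>]] by blast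
    obtain y where y: "y \<in> fin_supp" "N (\<sigma> k - y) < r / 2"
      using N_approx[OF \<sigma>X[of k], of "r / 2"] \<open>r > 0\<close> by auto
    have "norm (pairing \<phi> (x - y)) \<le> r" if "\<phi> \<in> \<Phi>" for \<phi>
    proof -
      have "pairing \<phi> (x - y) = pairing \<phi> (x - \<sigma> k) + pairing \<phi> (\<sigma> k - y)"
        by (simp add: pairing_diff)
      then have "norm (pairing \<phi> (x - y)) \<le> norm (pairing \<phi> (x - \<sigma> k)) + norm (pairing \<phi> (\<sigma> k - y))"
        by (simp add: norm_triangle_ineq)
      moreover have "norm (pairing \<phi> (\<sigma> k - y)) \<le> N (\<sigma> k - y)"
        using y fin_supp_subset_X by (intro pairing_le_N X_diff \<sigma>X that) auto
      moreover have "norm (pairing \<phi> (x - \<sigma> k)) \<le> r / 2" using k that by blast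
      ultimately show ?thesis using y(2) by linarith
    qed
    then show "\<exists>y\<in>fin_supp. \<forall>\<phi>\<in>\<Phi>. norm (pairing \<phi> (x - y)) \<le> r" using y by blast
  qed
  moreover have "\<exists>K. \<forall>k\<ge>K. \<sigma> k \<in> X \<and> norm_dist X N (\<sigma> k) x < r" if r: "r > 0" for r
  proof -
    obtain K where K: "\<forall>k\<ge>K. \<forall>\<phi>\<in>\<Phi>. norm (pairing \<phi> (x - \<sigma> k)) \<le> r / 2"
      using unif[OF half_gt_zero[OF r]] by blast
    have "norm_dist X N (\<sigma> k) x < r" if k: "k \<ge> K" for k
    proof -
      have "N (x - \<sigma> k) \<le> r / 2" using K k by (intro N_leI) auto
      then show ?thesis
        using r \<open>x \<in> X\<close> \<sigma>X ms.commute[of x "\<sigma> k"] by (simp add: norm_dist_eq)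
    qed
    then show ?thesis using \<sigma>X by blast
  qed
  ultimately show "\<exists>x. limitin ms.mtopology \<sigma> x sequentially"
    unfolding ms.limit_metric_sequentially by blast
qed

lemma separable: "separable_space (norm_topology X N)"
proof -
  obtain D :: "'f set" where D: "countable D" "\<And>U. open U \<Longrightarrow> U \<noteq> {} \<Longrightarrow> \<exists>d\<in>D. d \<in> U"
    using countable_dense_setE by blast
  define E where "E = (\<lambda>l i. if i < length l then l ! i else 0) ` lists D"
  have "countable E" unfolding E_def using D(1) by auto
  moreover have E: "E \<subseteq> X"
  proof -
    have "(\<lambda>i. if i < length l then l ! i else 0) \<in> fin_supp" for l :: "'f list"
      unfolding fin_supp_iff by (rule exI[of _ "length l"]) simp
    then have "E \<subseteq> fin_supp" unfolding E_def by blast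
    then show ?thesis using fin_supp_subset_X by blast
  qed
  moreover have "norm_topology X N closure_of E = X"
  proof (rule closure_of_eqI[OF E])
    fix y :: "nat \<Rightarrow> 'f" and r :: real assume y: "y \<in> fin_supp" and r: "r > 0"
    obtain m where m: "\<forall>i\<ge>m. y i = 0" using y by (auto simp: fin_supp_iff)
    define s where "s = r / (real m + 1)"
    have s: "s > 0" using r by (simp add: s_def)
    have "\<exists>d\<in>D. d \<in> ball (y i) s" for i using D(2)[of "ball (y i) s"] s by auto
    then obtain d where d: "\<And>i. d i \<in> D" "\<And>i. dist (y i) (d i) < s" by (metis mem_ball)
    define z where "z = (\<lambda>i. if i < length (map d [0..<m]) then map d [0..<m] ! i else 0)"
    have zE: "z \<in> E" unfolding E_def z_def by (rule imageI) (auto simp: d)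
    have z: "z i = (if i < m then d i else 0)" for i by (simp add: z_def)
    have "N (y - z) \<le> (\<Sum>i<m. norm ((y - z) i))"
      by (intro N_leI pairing_le_l1) (auto simp: z m)
    also have "\<dots> \<le> (\<Sum>i<m. s)"
      using d(2) by (intro sum_mono) (auto simp: z dist_norm intro: less_imp_le)
    also have "\<dots> < r" using r by (simp add: s_def field_simps)
    finally show "\<exists>d\<in>E. N (y - d) < r" using zE by blast
  qed
  ultimately show ?thesis unfolding separable_space_def
    using ms.topspace_mtopology by (metis norm_topology_def)
qed

lemma independent_units: "vs.independent (range unit_seq)"
  unfolding vs.dependent_def
proof clarify
  fix i :: nat assume "unit_seq i \<in> vs.span (range unit_seq - {unit_seq i :: nat \<Rightarrow> 'f})"
  then have "unit_seq i i = (0::'f)"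
  proof (rule vs.span_induct)
    show "vs.subspace {x :: nat \<Rightarrow> 'f. x i = 0}" by (auto simp: vs.subspace_def scale_seq_def)
  qed (auto simp: unit_seq_def)
  then show False by (simp add: unit_seq_def)
qed

lemma inj_unit_seq: "inj (unit_seq :: nat \<Rightarrow> nat \<Rightarrow> 'f)"
  by (rule injI) (metis unit_seq_def zero_neq_one)

lemma banach_space: "banach_space_on scale_seq X N"
proof (intro banach_space_on.intro normed_space banach_space_on_axioms.intro)
  show "Metric_space.mcomplete X (norm_dist X N)" by (rule mcomplete)
  show "separable_space (norm_topology X N)" by (rule separable)
  show "\<not> (\<exists>B. finite B \<and> B \<subseteq> X \<and> vs.span B = X)"
  proof clarify
    fix B assume "finite B" "vs.span B = X"
    then have "finite (range (unit_seq :: nat \<Rightarrow> nat \<Rightarrow> 'f))"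
      using vs.independent_span_bound[OF _ independent_units] unit_seq_in_X by blast
    then show False using finite_imageD[OF _ inj_unit_seq] by simp
  qed
qed

lemma N_unit_seq: "N (unit_seq i) = 1"
proof (rule antisym)
  show "N (unit_seq i) \<le> 1"
  proof (rule N_leI)
    fix \<phi> assume "\<phi> \<in> \<Phi>"
    then have "norm (pairing \<phi> (unit_seq i)) \<le> (\<Sum>k\<in>{i}. norm (unit_seq i k :: 'f))"
      by (rule pairing_le_l1) (auto simp: unit_seq_def)
    then show "norm (pairing \<phi> (unit_seq i)) \<le> 1" by (simp add: unit_seq_def)
  qed
  show "1 \<le> N (unit_seq i)" using coord_le_N[OF unit_seq_in_X, of i i] by (simp add: unit_seq_def)
qed

lemma dual_norm_coord: "dual_norm X N (\<lambda>x. x i) = 1"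
  unfolding dual_norm_def
proof (rule cSup_eq_maximum)
  show "1 \<in> (\<lambda>x. norm (x i)) ` {x \<in> X. N x \<le> 1}"
    by (rule image_eqI[of _ _ "unit_seq i"]) (auto simp: N_unit_seq unit_seq_in_X, simp add: unit_seq_def)
  show "y \<le> 1" if "y \<in> (\<lambda>x. norm (x i)) ` {x \<in> X. N x \<le> 1}" for y
    using that coord_le_N by (auto intro: order_trans)
qed

lemma fin_supp_subset_span: "fin_supp \<subseteq> vs.span (range unit_seq)"
proof
  fix y :: "nat \<Rightarrow> 'f" assume "y \<in> fin_supp"
  then have "y = (\<Sum>i | y i \<noteq> 0. scale_seq (y i) (unit_seq i))"
    by (subst sum_unit_seq) (auto simp: fin_supp_def)
  also have "\<dots> \<in> vs.span (range unit_seq)"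
    by (intro vs.span_sum vs.span_scale vs.span_base) auto
  finally show "y \<in> vs.span (range unit_seq)" .
qed

lemma markushevich: "markushevich_basis scale_seq X N unit_seq (\<lambda>i x. x i)"
  unfolding markushevich_basis_def is_basis_def
proof (intro conjI ballI impI)
  show "range unit_seq \<subseteq> X" using unit_seq_in_X by blast
  show "norm_topology X N closure_of vs.span (range unit_seq) = X"
  proof (rule closure_of_eqI)
    show "vs.span (range unit_seq) \<subseteq> X"
      using unit_seq_in_X by (intro vs.span_minimal subspace_X) auto
    fix y :: "nat \<Rightarrow> 'f" and r :: real assume "y \<in> fin_supp" "r > 0"
    moreover have "N (y - y) = 0" by (simp add: N_def Phi_nonempty)
    ultimately show "\<exists>d\<in>vs.span (range unit_seq). N (y - d) < r"
      using fin_supp_subset_span by (intro bexI[of _ y]) auto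
  qed
  show "range (\<lambda>i x. x i) \<subseteq> dual_space scale_seq X N"
    unfolding dual_space_def using coord_le_N
    by (auto simp: scale_seq_def intro!: exI[of _ 1])
  show "\<forall>k i. unit_seq i k = (if k = i then 1 else 0)" by (simp add: unit_seq_def)
  show "0 < (INF i. min (N (unit_seq i)) (dual_norm X N (\<lambda>x. x i)))"
    by (simp add: N_unit_seq dual_norm_coord)
  show "bdd_above (range (\<lambda>i. max (N (unit_seq i)) (dual_norm X N (\<lambda>x. x i))))"
    by (simp add: N_unit_seq dual_norm_coord)
  show "x = 0" if "\<forall>i. x i = 0" for x :: "nat \<Rightarrow> 'f" using that by (simp add: fun_eq_iff)
qed

text \<open>
  The adjoint of the partial sum projection is truncation of functionals, so truncation
  invariance of \<open>\<Phi>\<close> makes these projections contractions.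
\<close>

lemma schauder_if_truncation_closed:
  assumes trunc: "\<And>\<phi> m. \<phi> \<in> \<Phi> \<Longrightarrow> (\<lambda>i. if i < m then \<phi> i else 0) \<in> \<Phi>"
  shows "schauder_basis scale_seq X N unit_seq (\<lambda>i x. x i)"
  unfolding schauder_basis_def
proof (intro conjI markushevich exI[of _ 1] ballI allI)
  fix x m assume x: "x \<in> X"
  have "N (\<Sum>i<m. scale_seq (x i) (unit_seq i)) \<le> N x"
  proof (rule N_leI)
    fix \<phi> assume \<phi>: "\<phi> \<in> \<Phi>"
    let ?\<psi> = "\<lambda>i. if i < m then \<phi> i else 0"
    have "pairing \<phi> (\<Sum>i<m. scale_seq (x i) (unit_seq i)) = (\<Sum>i<m. \<phi> i * x i)"
      by (subst sum_unit_seq, simp, subst pairing_eq_sum[of _ "{..<m}"])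
         (auto simp: finite_support[OF \<phi>])
    also have "\<dots> = pairing ?\<psi> x" 
      unfolding pairing_def by (rule sum.mono_neutral_cong_right) auto
    finally show "norm (pairing \<phi> (\<Sum>i<m. scale_seq (x i) (unit_seq i))) \<le> N x"
      using pairing_le_N[OF x trunc[OF \<phi>, of m]] by simp
  qed
  then show "N (\<Sum>i<m. scale_seq (x i) (unit_seq i)) \<le> 1 * N x" by simp
qed simp

lemma pairing_sum_unit:
  assumes "\<phi> \<in> \<Phi>" "finite A"
  shows "pairing \<phi> (\<Sum>i\<in>A. scale_seq (a i) (unit_seq i)) = (\<Sum>i\<in>A. \<phi> i * a i)"
  by (subst sum_unit_seq[OF assms(2)], subst pairing_eq_sum[of _ A])
     (auto simp: assms finite_support)

lemma sum_unit_in_X: "finite A \<Longrightarrow> (\<Sum>i\<in>A. scale_seq (a i) (unit_seq i)) \<in> X"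
  by (intro vs.subspace_sum subspace_X X_scale unit_seq_in_X)

text \<open>
  The hypothesis is used twice. For the given \<open>a\<close> it gives the lower estimate, because
  \<open>\<bar>\<phi>(1\<^sub>A)\<bar> \<le> \<Sum>\<^sub>A \<bar>\<phi> i\<bar>\<close>. For \<open>a = 1\<close> it says that \<open>1\<^sub>A\<close> norms the mass \<open>\<Sum>\<^sub>A \<bar>\<phi> i\<bar>\<close>, which bounds
  \<open>\<bar>\<phi>(\<Sum>\<^sub>A a\<^sub>i e\<^sub>i)\<bar> / max \<bar>a\<^sub>i\<bar>\<close> from above.
\<close>

lemma UL_propertyI:
  assumes pos: "\<And>k. 0 < n k"
    and main: "\<And>A a \<phi> \<mu>. finite A \<Longrightarrow> card A \<in> range n \<Longrightarrow> \<phi> \<in> \<Phi> \<Longrightarrow> 0 \<le> \<mu> \<Longrightarrow>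
      (\<And>i. i \<in> A \<Longrightarrow> \<mu> \<le> norm (a i)) \<Longrightarrow>
      \<exists>\<psi>\<in>\<Phi>. \<mu> * (\<Sum>i\<in>A. norm (\<phi> i)) \<le> 2 * norm (\<Sum>i\<in>A. \<psi> i * a i)"
  shows "UL_property scale_seq N unit_seq n"
  unfolding UL_property_def
proof (intro exI[of _ 2] conjI allI impI)
  fix A :: "nat set" and a :: "nat \<Rightarrow> 'f"
  assume "finite A \<and> card A \<in> range n"
  then have fin: "finite A" and cA: "card A \<in> range n" by auto
  have "0 < card A" using cA pos by auto
  then have ne: "A \<noteq> {}" by auto
  let ?x = "\<Sum>i\<in>A. scale_seq (a i) (unit_seq i)"
  let ?o = "\<Sum>i\<in>A. unit_seq i :: nat \<Rightarrow> 'f"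
  let ?\<mu> = "Min ((\<lambda>i. norm (a i)) ` A)" and ?M = "Max ((\<lambda>i. norm (a i)) ` A)"
  have o: "?o = (\<Sum>i\<in>A. scale_seq 1 (unit_seq i))" by (simp add: scale_seq_def)
  have oX: "?o \<in> X" unfolding o by (rule sum_unit_in_X[OF fin])
  have po: "pairing \<phi> ?o = (\<Sum>i\<in>A. \<phi> i)" if "\<phi> \<in> \<Phi>" for \<phi>
    unfolding o using pairing_sum_unit[OF that fin, of "\<lambda>_. 1"] by simp
  have \<mu>0: "0 \<le> ?\<mu>" using fin ne by simp
  have M0: "0 \<le> ?M" using fin ne by (simp add: Max_ge_iff ex_in_conv)
  have "?\<mu> * N ?o \<le> 2 * N ?x"
  proof (cases "?\<mu> = 0")
    case True
    then show ?thesis using ns.norm_nonneg[OF sum_unit_in_X[OF fin]] by simp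
  next
    case False
    then have \<mu>: "?\<mu> > 0" using \<mu>0 by simp
    have "N ?o \<le> 2 * N ?x / ?\<mu>"
    proof (rule N_leI)
      fix \<phi> assume \<phi>: "\<phi> \<in> \<Phi>"
      have "\<exists>\<psi>\<in>\<Phi>. ?\<mu> * (\<Sum>i\<in>A. norm (\<phi> i)) \<le> 2 * norm (\<Sum>i\<in>A. \<psi> i * a i)"
        by (rule main[OF fin cA \<phi> \<mu>0]) (simp add: fin)
      then obtain \<psi> where \<psi>: "\<psi> \<in> \<Phi>" "?\<mu> * (\<Sum>i\<in>A. norm (\<phi> i)) \<le> 2 * norm (\<Sum>i\<in>A. \<psi> i * a i)"
        by blast
      have "norm (\<Sum>i\<in>A. \<psi> i * a i) \<le> N ?x"
        using pairing_le_N[OF sum_unit_in_X[OF fin] \<psi>(1), of a]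
        unfolding pairing_sum_unit[OF \<psi>(1) fin] .
      moreover have "?\<mu> * norm (pairing \<phi> ?o) \<le> ?\<mu> * (\<Sum>i\<in>A. norm (\<phi> i))"
        unfolding po[OF \<phi>] using \<mu>0 by (intro mult_left_mono norm_sum) auto
      ultimately have "?\<mu> * norm (pairing \<phi> ?o) \<le> 2 * N ?x" using \<psi>(2) by linarith
      then show "norm (pairing \<phi> ?o) \<le> 2 * N ?x / ?\<mu>" using \<mu> by (simp add: field_simps)
    qed
    then show ?thesis using \<mu> by (simp add: field_simps)
  qed
  then show "1 / 2 * ?\<mu> * N ?o \<le> N ?x" by simp
  show "N ?x \<le> 2 * ?M * N ?o"
  proof (rule N_leI)
    fix \<phi> assume \<phi>: "\<phi> \<in> \<Phi>"
    have "\<exists>\<psi>\<in>\<Phi>. 1 * (\<Sum>i\<in>A. norm (\<phi> i)) \<le> 2 * norm (\<Sum>i\<in>A. \<psi> i * 1)"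
      by (rule main[OF fin cA \<phi>]) simp_all
    then obtain \<psi> where \<psi>: "\<psi> \<in> \<Phi>" "(\<Sum>i\<in>A. norm (\<phi> i)) \<le> 2 * norm (\<Sum>i\<in>A. \<psi> i)"
      by auto
    have "norm (pairing \<phi> ?x) \<le> (\<Sum>i\<in>A. norm (\<phi> i) * ?M)"
      unfolding pairing_sum_unit[OF \<phi> fin]
      using fin by (intro sum_norm_le) (auto simp: norm_mult intro!: mult_left_mono)
    also have "\<dots> = (\<Sum>i\<in>A. norm (\<phi> i)) * ?M" by (rule sum_distrib_right[symmetric])
    also have "\<dots> \<le> (2 * N ?o) * ?M"
    proof (rule mult_right_mono[OF _ M0])
      show "(\<Sum>i\<in>A. norm (\<phi> i)) \<le> 2 * N ?o"
        using \<psi>(2) pairing_le_N[OF oX \<psi>(1)] unfolding po[OF \<psi>(1)] by linarith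
    qed
    finally show "norm (pairing \<phi> ?x) \<le> 2 * ?M * N ?o" by (simp add: mult_ac)
  qed
qed simp_all

text \<open>
  The square on the small side makes the ratio of the two norms at least \<open>\<surd>(h/2)\<close>, so a constant
  \<open>C\<close> would force \<open>h \<le> 2 C\<^sup>2\<close>.
\<close>

lemma not_unconditionalI:
  assumes "\<And>C :: real. \<exists>h m \<epsilon> \<epsilon>'. C < h \<and> (\<forall>i. norm (\<epsilon> i) = 1) \<and> (\<forall>i. norm (\<epsilon>' i) = 1) \<and>
     (\<exists>\<psi>\<in>\<Phi>. h \<le> norm (\<Sum>i<m. \<psi> i * \<epsilon> i)) \<and>
     (\<forall>\<phi>\<in>\<Phi>. (norm (\<Sum>i<m. \<phi> i * \<epsilon>' i))\<^sup>2 \<le> 2 * h)"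
  shows "\<not> unconditional_const_coeffs scale_seq N unit_seq"
proof
  assume "unconditional_const_coeffs scale_seq N unit_seq"
  then obtain C where C: "C > 0" and
    unc: "\<forall>A. finite A \<longrightarrow> (\<forall>\<epsilon> \<epsilon>' :: nat \<Rightarrow> 'f.
      (\<forall>i\<in>A. norm (\<epsilon> i) = 1) \<and> (\<forall>i\<in>A. norm (\<epsilon>' i) = 1) \<longrightarrow>
      N (\<Sum>i\<in>A. scale_seq (\<epsilon> i) (unit_seq i)) \<le> C * N (\<Sum>i\<in>A. scale_seq (\<epsilon>' i) (unit_seq i)))"
    unfolding unconditional_const_coeffs_def by (elim exE conjE)
  obtain h m \<epsilon> \<epsilon>' \<psi> where h: "2 * C\<^sup>2 < h" and \<epsilon>: "\<forall>i. norm (\<epsilon> i) = 1" "\<forall>i. norm (\<epsilon>' i) = 1"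
    and \<psi>: "\<psi> \<in> \<Phi>" "h \<le> norm (\<Sum>i<m. \<psi> i * \<epsilon> i)"
    and \<phi>: "\<And>\<phi>. \<phi> \<in> \<Phi> \<Longrightarrow> (norm (\<Sum>i<m. \<phi> i * \<epsilon>' i))\<^sup>2 \<le> 2 * h"
    using assms[of "2 * C\<^sup>2"] by blast
  let ?S = "\<lambda>\<epsilon>. \<Sum>i<m. scale_seq (\<epsilon> i) (unit_seq i)"
  have h0: "h > 0" using h zero_le_power2[of C] by linarith
  note fin = finite_lessThan[of m]
  have "h \<le> N (?S \<epsilon>)"
    using pairing_le_N[OF sum_unit_in_X[OF fin] \<psi>(1), of \<epsilon>] \<psi>(2)
    unfolding pairing_sum_unit[OF \<psi>(1) fin] by linarith
  also have "\<dots> \<le> C * N (?S \<epsilon>')" using \<epsilon> by (intro unc[rule_format, OF fin]) blast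
  also have "\<dots> \<le> C * sqrt (2 * h)"
  proof (intro mult_left_mono N_leI)
    fix \<phi>' assume p: "\<phi>' \<in> \<Phi>"
    show "norm (pairing \<phi>' (?S \<epsilon>')) \<le> sqrt (2 * h)"
      unfolding pairing_sum_unit[OF p fin] by (rule real_le_rsqrt[OF \<phi>[OF p]])
  qed (use C in simp)
  finally have "h\<^sup>2 \<le> (C * sqrt (2 * h))\<^sup>2" using h0 by (intro power_mono) auto
  also have "\<dots> = (2 * C\<^sup>2) * h" using h0 by (simp add: power_mult_distrib)
  finally have "h \<le> 2 * C\<^sup>2" using h0 by (simp add: power2_eq_square)
  then show False using h by simp
qed

end


section \<open>Combining functionals of sparsely chosen scales\<close>

definition with_units :: "nat set \<Rightarrow> (nat \<Rightarrow> (nat \<Rightarrow> 'f::real_normed_field) set) \<Rightarrow> (nat \<Rightarrow> 'f) set" where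
  "with_units H F = range unit_seq \<union> (\<Union>h\<in>H. F h)"

text \<open>
  The scale \<open>h\<close> fixes two bounds for \<open>F h\<close>. The entries are at most \<open>1/h\<close>, so on the initial block of
  length \<open>M l\<close> of a smaller scale \<open>l\<close> the family contributes at most 1. The total mass is at most \<open>2 h\<close>,
  which is at most the square root of twice any larger scale, since \<open>2 h\<^sup>2 \<le> M h\<close>.
\<close>

locale sparse_family =
  fixes H :: "nat set" and M :: "nat \<Rightarrow> nat"
    and F :: "nat \<Rightarrow> (nat \<Rightarrow> 'f::{real_normed_field,euclidean_space}) set"
  assumes inf_H: "infinite H"
    and H_ge: "\<And>h. h \<in> H \<Longrightarrow> 2 \<le> h"
    and H_sep: "\<And>l h. l \<in> H \<Longrightarrow> h \<in> H \<Longrightarrow> l < h \<Longrightarrow> M l \<le> h"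
    and M_ge: "\<And>h. h \<in> H \<Longrightarrow> 2 * h\<^sup>2 \<le> M h"
    and F_fin: "\<And>h \<phi>. h \<in> H \<Longrightarrow> \<phi> \<in> F h \<Longrightarrow> finite {i. \<phi> i \<noteq> 0}"
    and F_sup: "\<And>h \<phi> i. h \<in> H \<Longrightarrow> \<phi> \<in> F h \<Longrightarrow> norm (\<phi> i) \<le> 1 / real h"
    and F_sum: "\<And>h \<phi> A. h \<in> H \<Longrightarrow> \<phi> \<in> F h \<Longrightarrow> finite A \<Longrightarrow> (\<Sum>i\<in>A. norm (\<phi> i)) \<le> 2 * real h"
begin

sublocale norming_set "with_units H F"
proof
  fix \<phi> i
  assume "\<phi> \<in> with_units H F"
  then consider k where "\<phi> = unit_seq k" | h where "h \<in> H" "\<phi> \<in> F h"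
    unfolding with_units_def by blast
  then have "finite {i. \<phi> i \<noteq> 0} \<and> norm (\<phi> i) \<le> 1"
  proof cases
    case 1
    have "{i. \<phi> i \<noteq> 0} \<subseteq> {k}" unfolding 1 by (auto simp: unit_seq_def)
    then show ?thesis unfolding 1 by (auto simp: unit_seq_def intro: finite_subset)
  next
    case 2
    have "1 / real h \<le> 1" using H_ge[OF 2(1)] by simp
    then show ?thesis using F_fin[OF 2] F_sup[OF 2, of i] by simp
  qed
  then show "finite {i. \<phi> i \<noteq> 0}" "norm (\<phi> i) \<le> 1" by auto
qed (simp add: with_units_def)

lemma UL_property_if_families:
  assumes pos: "\<And>k. 0 < n k"
    and main: "\<And>A a \<phi> \<mu> h. h \<in> H \<Longrightarrow> finite A \<Longrightarrow> card A \<in> range n \<Longrightarrow> \<phi> \<in> F h \<Longrightarrow> 0 \<le> \<mu> \<Longrightarrow>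
      (\<And>i. i \<in> A \<Longrightarrow> \<mu> \<le> norm (a i)) \<Longrightarrow>
      \<exists>\<psi>\<in>F h. \<mu> * (\<Sum>i\<in>A. norm (\<phi> i)) \<le> 2 * norm (\<Sum>i\<in>A. \<psi> i * a i)"
  shows "UL_property scale_seq N unit_seq n"
proof (rule UL_propertyI[OF pos])
  fix A :: "nat set" and a \<phi> :: "nat \<Rightarrow> 'f" and \<mu> :: real
  assume A: "finite A" "card A \<in> range n" and \<phi>: "\<phi> \<in> with_units H F" and \<mu>: "0 \<le> \<mu>"
    and a: "\<And>i. i \<in> A \<Longrightarrow> \<mu> \<le> norm (a i)"
  from \<phi> consider k where "\<phi> = unit_seq k" | h where "h \<in> H" "\<phi> \<in> F h"
    unfolding with_units_def by blast
  then show "\<exists>\<psi>\<in>with_units H F. \<mu> * (\<Sum>i\<in>A. norm (\<phi> i)) \<le> 2 * norm (\<Sum>i\<in>A. \<psi> i * a i)"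
  proof cases
    case 1
    have "(\<Sum>i\<in>A. norm (\<phi> i)) = (\<Sum>i\<in>A. if i = k then 1 else 0)"
      unfolding 1 by (intro sum.cong) (auto simp: unit_seq_def)
    moreover have "(\<Sum>i\<in>A. \<phi> i * a i) = (\<Sum>i\<in>A. if i = k then a i else 0)"
      unfolding 1 by (intro sum.cong) (auto simp: unit_seq_def)
    ultimately have "\<mu> * (\<Sum>i\<in>A. norm (\<phi> i)) \<le> 2 * norm (\<Sum>i\<in>A. \<phi> i * a i)"
      using A a[of k] \<mu> by (cases "k \<in> A") auto
    then show ?thesis using \<phi> by blast
  next
    case 2
    then have "\<exists>\<psi>\<in>F h. \<mu> * (\<Sum>i\<in>A. norm (\<phi> i)) \<le> 2 * norm (\<Sum>i\<in>A. \<psi> i * a i)"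
      using A \<mu> a by (intro main)
    then show ?thesis using 2(1) unfolding with_units_def by blast
  qed
qed

text \<open>
  Only the family of scale \<open>h\<close> is examined by the hypotheses, on the initial block of length \<open>M h\<close>;
  the other scales are controlled by their entries (above \<open>h\<close>) or their total mass (below \<open>h\<close>).
\<close>

lemma not_unconditional:
  assumes \<epsilon>: "\<And>i. norm (\<epsilon> i) = 1" "\<And>i. norm (\<epsilon>' i) = 1"
    and large: "\<And>h. h \<in> H \<Longrightarrow> \<exists>\<psi>\<in>F h. real h \<le> norm (\<Sum>i<M h. \<psi> i * \<epsilon> i)"
    and small: "\<And>h \<phi>. h \<in> H \<Longrightarrow> \<phi> \<in> F h \<Longrightarrow> norm (\<Sum>i<M h. \<phi> i * \<epsilon>' i) \<le> 1"
  shows "\<not> unconditional_const_coeffs scale_seq N unit_seq"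
proof (rule not_unconditionalI)
  fix C :: real
  obtain h where h: "h \<in> H" "nat \<lceil>C\<rceil> < h"
    using inf_H by (meson infinite_nat_iff_unbounded)
  have h2: "2 \<le> h" by (rule H_ge[OF h(1)])
  have bound: "(norm (\<Sum>i<M h. \<phi> i * \<epsilon>' i))\<^sup>2 \<le> 2 * real h" if \<phi>: "\<phi> \<in> with_units H F" for \<phi>
  proof -
    let ?s = "norm (\<Sum>i<M h. \<phi> i * \<epsilon>' i)"
    have le_sum: "?s \<le> (\<Sum>i<M h. norm (\<phi> i))"
      by (rule sum_norm_le) (simp add: norm_mult \<epsilon>)
    have one: "?s\<^sup>2 \<le> 2 * real h" if "?s \<le> 1"
    proof -
      have "?s\<^sup>2 \<le> 1" using that by (simp add: power_le_one)
      then show ?thesis using h2 by simp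
    qed
    from \<phi> consider k where "\<phi> = unit_seq k" | l where "l \<in> H" "\<phi> \<in> F l"
      unfolding with_units_def by blast
    then show ?thesis
    proof cases
      case 1
      have "(\<Sum>i<M h. norm (\<phi> i)) = (\<Sum>i<M h. if i = k then 1 else 0)"
        unfolding 1 by (intro sum.cong) (auto simp: unit_seq_def)
      also have "\<dots> \<le> 1" by simp
      finally show ?thesis using le_sum one by linarith
    next
      case 2
      consider "h < l" | "l = h" | "l < h" by linarith
      then show ?thesis
      proof cases
        case 1
        have "(\<Sum>i<M h. norm (\<phi> i)) \<le> (\<Sum>i<M h. 1 / real l)"
          by (intro sum_mono F_sup[OF 2])
        also have "\<dots> \<le> 1" using H_sep[OF h(1) 2(1) 1] 1 by (simp add: divide_le_eq)
        finally show ?thesis using le_sum one by linarith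
      next
        case 3
        have "?s \<le> 2 * real l" using le_sum F_sum[OF 2, of "{..<M h}"] by simp
        then have "?s\<^sup>2 \<le> (2 * real l)\<^sup>2" by (intro power_mono) auto
        also have "\<dots> = 2 * real (2 * l\<^sup>2)" by (simp add: power_mult_distrib)
        also have "\<dots> \<le> 2 * real h"
          using M_ge[OF 2(1)] H_sep[OF 2(1) h(1) 3] by (simp only: of_nat_le_iff mult_le_cancel_left_pos zero_less_numeral)
        finally show ?thesis .
      qed (use small[OF 2] one in simp)
    qed
  qed
  obtain \<psi> where \<psi>: "\<psi> \<in> F h" "real h \<le> norm (\<Sum>i<M h. \<psi> i * \<epsilon> i)"
    using large[OF h(1)] by blast
  have \<psi>': "\<psi> \<in> with_units H F" using \<psi>(1) h(1) unfolding with_units_def by blast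
  have "C < real h" using h(2) by linarith
  then show "\<exists>h m \<epsilon> \<epsilon>'. C < h \<and> (\<forall>i. norm (\<epsilon> i) = 1) \<and> (\<forall>i. norm (\<epsilon>' i) = 1) \<and>
     (\<exists>\<psi>\<in>with_units H F. h \<le> norm (\<Sum>i<m. \<psi> i * \<epsilon> i)) \<and>
     (\<forall>\<phi>\<in>with_units H F. (norm (\<Sum>i<m. \<phi> i * \<epsilon>' i))\<^sup>2 \<le> 2 * h)"
    using \<epsilon> bound \<psi>(2) \<psi>'
    by (intro exI[of _ "real h"] exI[of _ "M h"] exI[of _ \<epsilon>] exI[of _ \<epsilon>'] conjI allI ballI bexI[of _ \<psi>])
qed

end

text \<open>The iterates of \<open>M\<close> starting at 2 form such a set.\<close>

lemma sparse_set_exists: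
  fixes M :: "nat \<Rightarrow> nat"
  assumes grow: "\<And>h. 2 \<le> h \<Longrightarrow> h < M h"
  obtains H where "infinite H" "\<And>h. h \<in> H \<Longrightarrow> 2 \<le> h"
    "\<And>l h. l \<in> H \<Longrightarrow> h \<in> H \<Longrightarrow> l < h \<Longrightarrow> M l \<le> h"
proof -
  define s where "s j = (M ^^ j) 2" for j
  have s_Suc: "s (Suc j) = M (s j)" for j by (simp add: s_def)
  have s2: "2 \<le> s j" for j
  proof (induction j)
    case (Suc j)
    then show ?case using grow[of "s j"] by (simp add: s_Suc)
  qed (simp add: s_def)
  have mono: "strict_mono s"
    unfolding strict_mono_Suc_iff using grow s2 s_Suc by simp
  have "M l \<le> h" if lh: "l \<in> range s" "h \<in> range s" "l < h" for l h
  proof -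
    obtain a b where ab: "l = s a" "h = s b" using lh by blast
    then have "Suc a \<le> b" using lh(3) mono by (simp add: strict_mono_less Suc_le_eq)
    then have "s (Suc a) \<le> s b" using mono by (simp add: strict_mono_less_eq)
    then show ?thesis by (simp add: ab s_Suc)
  qed
  moreover have "infinite (range s)"
    using mono by (simp add: finite_image_iff strict_mono_imp_inj_on)
  ultimately show ?thesis using that[of "range s"] s2 by blast
qed

lemma frequently_large:
  fixes f :: "nat \<Rightarrow> real"
  assumes "limsup (\<lambda>k. ereal (f k)) = \<infinity>"
  obtains k where "K \<le> k" "C \<le> f k"
proof -
  have "\<exists>k\<ge>K. C \<le> f k"
  proof (rule ccontr)
    assume "\<not> ?thesis"
    then have "\<forall>k\<ge>K. f k \<le> C" by (meson linorder_le_cases)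
    then have "\<forall>\<^sub>F k in sequentially. ereal (f k) \<le> ereal C"
      unfolding eventually_sequentially by (intro exI[of _ K]) simp
    then have "limsup (\<lambda>k. ereal (f k)) \<le> ereal C" by (rule Limsup_bounded)
    then show False using assms by simp
  qed
  then show ?thesis using that by blast
qed

section \<open>Functionals with bounded entries and bounded support\<close>

text \<open>The inverse of the sign of \<open>c\<close>, with value 1 at 0 so that it always has modulus one.\<close>

definition unimod :: "'f::real_normed_field \<Rightarrow> 'f" where
  "unimod c = (if c = 0 then 1 else of_real (norm c) / c)"

lemma norm_unimod [simp]: "norm (unimod c) = 1"
  by (simp add: unimod_def norm_divide)

lemma unimod_mult: "unimod c * c = of_real (norm c)"
  by (simp add: unimod_def)

lemma sum_unimod_ge:
  assumes "finite A" "S \<subseteq> A" "0 \<le> \<mu>" "0 \<le> c" "\<And>i. i \<in> A \<Longrightarrow> \<mu> \<le> norm (a i)"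
    and \<psi>: "\<And>i. i \<in> A \<Longrightarrow> \<psi> i = (if i \<in> S then of_real c * unimod (a i) else 0)"
  shows "\<mu> * (c * card S) \<le> norm (\<Sum>i\<in>A. \<psi> i * a i)"
proof -
  have "(\<Sum>i\<in>A. \<psi> i * a i) = (\<Sum>i\<in>S. of_real c * (unimod (a i) * a i))"
    using assms(1,2) \<psi> by (intro sum.mono_neutral_cong_right) auto
  also have "\<dots> = of_real (\<Sum>i\<in>S. c * norm (a i))"
    by (simp add: unimod_mult)
  finally have "norm (\<Sum>i\<in>A. \<psi> i * a i) = \<bar>\<Sum>i\<in>S. c * norm (a i)\<bar>"
    by (simp only: norm_of_real)
  also have "\<dots> = (\<Sum>i\<in>S. c * norm (a i))"
    using \<open>0 \<le> c\<close> by (intro abs_of_nonneg sum_nonneg) simp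
  also have "\<dots> \<ge> (\<Sum>i\<in>S. c * \<mu>)"
    using assms by (intro sum_mono mult_left_mono) auto
  finally show ?thesis by (simp add: mult_ac)
qed

definition box :: "real \<Rightarrow> nat \<Rightarrow> (nat \<Rightarrow> 'f::real_normed_field) set" where
  "box c s = {\<phi>. finite {i. \<phi> i \<noteq> 0} \<and> card {i. \<phi> i \<noteq> 0} \<le> s \<and> (\<forall>i. norm (\<phi> i) \<le> c)}"

lemma boxI:
  assumes "finite S" "card S \<le> s" "\<And>i. i \<notin> S \<Longrightarrow> \<phi> i = 0" "\<And>i. norm (\<phi> i) \<le> c"
  shows "\<phi> \<in> box c s"
proof -
  have sub: "{i. \<phi> i \<noteq> 0} \<subseteq> S" using assms(3) by blast
  show ?thesis unfolding box_def
    using finite_subset[OF sub assms(1)] card_mono[OF assms(1) sub] assms(2,4) by simp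
qed

text \<open>
  Boxes do not see signs: on a vector with support \<open>A\<close> and entries of modulus one, the value of this
  bound is attained by the functional of a suitable sign pattern (\<open>box_attains\<close>).
\<close>

lemma sum_box_le:
  assumes \<phi>: "\<phi> \<in> box c s" and A: "finite A"
  shows "(\<Sum>i\<in>A. norm (\<phi> i)) \<le> c * min (card A) s"
proof -
  let ?S = "A \<inter> {i. \<phi> i \<noteq> 0}"
  have "norm (\<phi> 0) \<le> c" using \<phi> by (simp add: box_def)
  then have c: "0 \<le> c" by (rule order_trans[OF norm_ge_zero])
  have "card ?S \<le> card A" using A by (intro card_mono) auto
  moreover have "card ?S \<le> card {i. \<phi> i \<noteq> 0}" using \<phi> by (intro card_mono) (auto simp: box_def)
  ultimately have card: "card ?S \<le> min (card A) s" using \<phi> by (auto simp: box_def)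
  have "(\<Sum>i\<in>A. norm (\<phi> i)) = (\<Sum>i\<in>?S. norm (\<phi> i))"
    using A by (intro sum.mono_neutral_right) auto
  also have "\<dots> \<le> (\<Sum>i\<in>?S. c)" using \<phi> by (intro sum_mono) (auto simp: box_def)
  also have "\<dots> = c * card ?S" by simp
  also have "\<dots> \<le> c * min (card A) s" using card c by (intro mult_left_mono) auto
  finally show ?thesis .
qed

lemma box_attains:
  assumes A: "finite A" and c: "0 \<le> c" and \<mu>: "0 \<le> \<mu>" "\<And>i. i \<in> A \<Longrightarrow> \<mu> \<le> norm (a i)"
  obtains \<psi> where "\<psi> \<in> box c s" "\<mu> * (c * min (card A) s) \<le> norm (\<Sum>i\<in>A. \<psi> i * a i)"
proof -
  obtain S where S: "S \<subseteq> A" "card S = min (card A) s"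
    using obtain_subset_with_card_n[of "min (card A) s" A] by auto
  let ?\<psi> = "\<lambda>i. if i \<in> S then of_real c * unimod (a i) else 0"
  have "?\<psi> \<in> box c s"
    using S A c by (intro boxI[of S]) (auto simp: norm_mult intro: finite_subset)
  moreover have "\<mu> * (c * card S) \<le> norm (\<Sum>i\<in>A. ?\<psi> i * a i)"
    by (rule sum_unimod_ge[OF A S(1) \<mu>(1) c \<mu>(2)]) auto
  ultimately show ?thesis unfolding S(2) by (rule that)
qed


text \<open>
  The zero-sum constraint on \<open>{..<m}\<close> costs nothing for sets whose size is at distance \<open>g\<close> from \<open>m\<close>.
  A set with \<open>\<bar>A\<bar> \<ge> m + g\<close> has \<open>g\<close> points outside \<open>{..<m}\<close>, which the constraint ignores. A
  set with \<open>\<bar>A\<bar> \<le> m - g\<close> leaves \<open>g\<close> points of \<open>{..<m}\<close> free, and the sum of the chosen entries is spread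
  over as many of them with opposite sign; they are invisible to a vector supported on \<open>A\<close>.
\<close>

lemma balanced_box_attains:
  assumes A: "finite A" "A \<noteq> {}" and g: "0 < g" "card A + g \<le> m \<or> m + g \<le> card A"
    and c: "0 \<le> c" and \<mu>: "0 \<le> \<mu>" "\<And>i. i \<in> A \<Longrightarrow> \<mu> \<le> norm (a i)"
  obtains \<psi> where "\<psi> \<in> box c (2 * g)" "(\<Sum>i<m. \<psi> i) = 0"
    "\<mu> * (c * min (card A) g) \<le> norm (\<Sum>i\<in>A. \<psi> i * a i)"
proof -
  define s where "s = min (card A) g"
  have s: "0 < s" "s \<le> g" "s \<le> card A"
    using A g by (auto simp: s_def card_gt_0_iff)
  consider "m + g \<le> card A" | "card A + g \<le> m" using g(2) by blast
  then show ?thesis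
  proof cases
    case 1
    have "card A \<le> card (A - {..<m}) + m"
      using diff_card_le_card_Diff[of "{..<m}" A] by simp
    then have "s \<le> card (A - {..<m})" using 1 s by linarith
    then obtain S where S: "S \<subseteq> A - {..<m}" "card S = s" "finite S"
      using obtain_subset_with_card_n by blast
    let ?\<psi> = "\<lambda>i. if i \<in> S then of_real c * unimod (a i) else 0"
    have "?\<psi> \<in> box c (2 * g)"
      using S s c by (intro boxI[of S]) (auto simp: norm_mult)
    moreover have "(\<Sum>i<m. ?\<psi> i) = 0" using S(1) by (intro sum.neutral) auto
    moreover have "\<mu> * (c * card S) \<le> norm (\<Sum>i\<in>A. ?\<psi> i * a i)"
      using S(1) by (intro sum_unimod_ge[OF A(1) _ \<mu>(1) c \<mu>(2)]) auto
    ultimately show ?thesis unfolding S(2) s_def by (rule that)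
  next
    case 2
    obtain S where S: "S \<subseteq> A" "card S = s" "finite S"
      using obtain_subset_with_card_n[OF s(3)] by blast
    have "m \<le> card ({..<m} - A) + card A"
      using diff_card_le_card_Diff[OF A(1), of "{..<m}"] by simp
    then have "s \<le> card ({..<m} - A)" using 2 s by linarith
    then obtain T where T: "T \<subseteq> {..<m} - A" "card T = s" "finite T"
      using obtain_subset_with_card_n by blast
    define \<sigma> where "\<sigma> = (\<Sum>i\<in>S \<inter> {..<m}. unimod (a i))"
    have "norm \<sigma> \<le> (\<Sum>i\<in>S \<inter> {..<m}. 1)"
      unfolding \<sigma>_def by (rule sum_norm_le) simp
    also have "\<dots> \<le> real s"
      using card_mono[OF S(3), of "S \<inter> {..<m}"] S(2) by simp
    finally have \<sigma>: "norm \<sigma> \<le> real s" .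
    (* Minus tau is the entry on T: a sum of at most s numbers of modulus c, shared among s points. *)
    define \<tau> where "\<tau> = of_real c * \<sigma> / of_nat s"
    have "norm \<tau> = c * (norm \<sigma> / real s)" using c by (simp add: \<tau>_def norm_mult norm_divide)
    also have "\<dots> \<le> c * 1" using \<sigma> s(1) c by (intro mult_left_mono) (auto simp: divide_le_eq)
    finally have \<tau>: "norm \<tau> \<le> c" by simp
    let ?\<psi> = "\<lambda>i. if i \<in> S then of_real c * unimod (a i) else if i \<in> T then - \<tau> else 0"
    have "card (S \<union> T) \<le> 2 * g" using card_Un_le[of S T] S T s by linarith
    then have "?\<psi> \<in> box c (2 * g)"
      using S T \<tau> c by (intro boxI[of "S \<union> T"]) (auto simp: norm_mult)
    moreover have "(\<Sum>i<m. ?\<psi> i) = 0"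
    proof -
      have "(\<Sum>i<m. ?\<psi> i) = (\<Sum>i<m. if i \<in> S then of_real c * unimod (a i) else 0)
          + (\<Sum>i<m. if i \<in> T then - \<tau> else 0)"
        unfolding sum.distrib[symmetric] using S(1) T(1) by (intro sum.cong) auto
      also have "(\<Sum>i<m. if i \<in> S then of_real c * unimod (a i) else 0) = of_real c * \<sigma>"
        unfolding \<sigma>_def sum_distrib_left by (intro sum.mono_neutral_cong_right) auto
      also have "(\<Sum>i<m. if i \<in> T then - \<tau> else 0) = (\<Sum>i\<in>T. - \<tau>)"
        using T(1) by (intro sum.mono_neutral_cong_right) auto
      also have "\<dots> = - (of_real c * \<sigma>)" using s(1) T(2) by (simp add: \<tau>_def)
      finally show ?thesis by simp
    qed
    moreover have "\<mu> * (c * card S) \<le> norm (\<Sum>i\<in>A. ?\<psi> i * a i)"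
      using T(1) by (intro sum_unimod_ge[OF A(1) S(1) \<mu>(1) c \<mu>(2)]) auto
    ultimately show ?thesis unfolding S(2) s_def by (rule that)
  qed
qed

section \<open>The two constructions\<close>

lemma sum_alternating: "(\<Sum>i<r. (-1) ^ i) = (if even r then 0 else 1 :: 'f::real_normed_field)"
  by (induction r) auto

text \<open>
  The distance \<open>h\<^sup>2\<close> of \<open>M h\<close> from the values of \<open>n\<close>, against entries of size \<open>1/h\<close>, gives the family of
  scale \<open>h\<close> total mass about \<open>h\<close>. The alternating signs on \<open>{..<M h}\<close> are normed by an alternating
  functional of even length, which has sum zero, while \<open>1\<close> on \<open>{..<M h}\<close> is annihilated.
\<close>

lemma additive_gaps_markushevich:
  assumes mono: "strict_mono n" and pos: "\<And>k. 0 < n k" and gaps: "additive_gaps n"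
  shows "\<exists>(X :: (nat \<Rightarrow> 'f::{real_normed_field,euclidean_space}) set) N e f.
    banach_space_on scale_seq X N \<and> markushevich_basis scale_seq X N e f \<and>
    UL_property scale_seq N e n \<and> \<not> unconditional_const_coeffs scale_seq N e"
proof -
  have "\<exists>m. 2 * h\<^sup>2 \<le> m \<and> (\<forall>i. n i + h\<^sup>2 \<le> m \<or> m + h\<^sup>2 \<le> n i)" for h :: nat
  proof -
    obtain k where k: "2 * h\<^sup>2 \<le> k" "real (2 * h\<^sup>2) \<le> real (n (Suc k)) - real (n k)"
      using frequently_large[OF gaps[unfolded additive_gaps_def], of "2 * h\<^sup>2" "real (2 * h\<^sup>2)"] by blast
    have nk: "k \<le> n k" by (rule strict_mono_imp_increasing[OF mono])
    have gap: "n k + 2 * h\<^sup>2 \<le> n (Suc k)" using k(2) by linarith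
    have "n i + h\<^sup>2 \<le> n k + h\<^sup>2 \<or> n k + h\<^sup>2 + h\<^sup>2 \<le> n i" for i
    proof (cases "i \<le> k")
      case True
      then show ?thesis using mono by (simp add: strict_mono_less_eq)
    next
      case False
      then have "n (Suc k) \<le> n i" using mono by (simp add: strict_mono_less_eq)
      then show ?thesis using gap by linarith
    qed
    (* The point h^2 above n k; k >= 2 h^2 makes it large enough for the support bound 2 h^2. *)
    then show ?thesis using k(1) nk by (intro exI[of _ "n k + h\<^sup>2"]) auto
  qed
  then obtain M where M: "\<And>h. 2 * h\<^sup>2 \<le> M h" "\<And>h i. n i + h\<^sup>2 \<le> M h \<or> M h + h\<^sup>2 \<le> n i"
    by metis
  have grow: "h < M h" if "2 \<le> h" for h
  proof -
    have "h < 2 * h\<^sup>2" using that by (simp add: power2_eq_square)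
    then show ?thesis using M(1)[of h] by linarith
  qed
  obtain H where H: "infinite H" "\<And>h. h \<in> H \<Longrightarrow> 2 \<le> h"
    "\<And>l h. l \<in> H \<Longrightarrow> h \<in> H \<Longrightarrow> l < h \<Longrightarrow> M l \<le> h"
    using sparse_set_exists[of M] grow by blast
  define F :: "nat \<Rightarrow> (nat \<Rightarrow> 'f) set" where
    "F h = {\<phi> \<in> box (1 / real h) (2 * h\<^sup>2). (\<Sum>i<M h. \<phi> i) = 0}" for h
  have F_box: "\<phi> \<in> box (1 / real h) (2 * h\<^sup>2)" if "\<phi> \<in> F h" for \<phi> h
    using that by (simp add: F_def)
  interpret sparse_family H M F
  proof (rule sparse_family.intro[OF H(1-3) M(1)])
    fix h \<phi> i assume \<phi>: "h \<in> H" "\<phi> \<in> F h"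
    show "finite {i. \<phi> i \<noteq> 0}" "norm (\<phi> i) \<le> 1 / real h"
      using F_box[OF \<phi>(2)] by (auto simp: box_def)
  next
    fix h \<phi> and A :: "nat set" assume \<phi>: "h \<in> H" "\<phi> \<in> F h" "finite A"
    have "(\<Sum>i\<in>A. norm (\<phi> i)) \<le> 1 / real h * min (card A) (2 * h\<^sup>2)"
      by (rule sum_box_le[OF F_box[OF \<phi>(2)] \<phi>(3)])
    also have "\<dots> \<le> 1 / real h * real (2 * h\<^sup>2)"
      by (intro mult_left_mono of_nat_mono min.cobounded2) simp
    also have "\<dots> = 2 * real h" using H(2)[OF \<phi>(1)] by (simp add: power2_eq_square)
    finally show "(\<Sum>i\<in>A. norm (\<phi> i)) \<le> 2 * real h" .
  qed
  have "UL_property scale_seq N unit_seq n"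
  proof (rule UL_property_if_families[OF pos])
    fix A :: "nat set" and a \<phi> :: "nat \<Rightarrow> 'f" and \<mu> :: real and h
    assume h: "h \<in> H" and A: "finite A" "card A \<in> range n" and \<phi>: "\<phi> \<in> F h"
      and \<mu>: "0 \<le> \<mu>" "\<And>i. i \<in> A \<Longrightarrow> \<mu> \<le> norm (a i)"
    have "0 < card A" using A(2) pos by auto
    then have ne: "A \<noteq> {}" by auto
    have g: "0 < h\<^sup>2" using H(2)[OF h] by simp
    obtain i where i: "card A = n i" using A(2) by blast
    have sep: "card A + h\<^sup>2 \<le> M h \<or> M h + h\<^sup>2 \<le> card A" using M(2)[of i h] unfolding i .
    have c: "0 \<le> 1 / real h" by simp
    obtain \<psi> where \<psi>: "\<psi> \<in> box (1 / real h) (2 * h\<^sup>2)" "(\<Sum>i<M h. \<psi> i) = 0"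
      "\<mu> * (1 / real h * min (card A) (h\<^sup>2)) \<le> norm (\<Sum>i\<in>A. \<psi> i * a i)"
      using balanced_box_attains[OF A(1) ne g sep c \<mu>] .
    have "(\<Sum>i\<in>A. norm (\<phi> i)) \<le> 1 / real h * min (card A) (2 * h\<^sup>2)"
      by (rule sum_box_le[OF F_box[OF \<phi>] A(1)])
    also have "\<dots> \<le> 1 / real h * (2 * min (card A) (h\<^sup>2))"
      by (intro mult_left_mono) auto
    finally have "\<mu> * (\<Sum>i\<in>A. norm (\<phi> i)) \<le> \<mu> * (1 / real h * (2 * min (card A) (h\<^sup>2)))"
      by (rule mult_left_mono[OF _ \<mu>(1)])
    also have "\<dots> = 2 * (\<mu> * (1 / real h * min (card A) (h\<^sup>2)))" by simp
    also have "\<dots> \<le> 2 * norm (\<Sum>i\<in>A. \<psi> i * a i)" using \<psi>(3) by linarith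
    finally show "\<exists>\<psi>\<in>F h. \<mu> * (\<Sum>i\<in>A. norm (\<phi> i)) \<le> 2 * norm (\<Sum>i\<in>A. \<psi> i * a i)"
      using \<psi>(1,2) unfolding F_def by blast
  qed
  moreover have "\<not> unconditional_const_coeffs scale_seq N unit_seq"
  proof (rule not_unconditional[of "\<lambda>i. (-1) ^ i" "\<lambda>_. 1"])
    fix h assume h: "h \<in> H"
    let ?g = "2 * h\<^sup>2"
    let ?\<psi> = "\<lambda>i. if i < ?g then of_real (1 / real h) * (-1) ^ i else 0 :: 'f"
    have sum: "(\<Sum>i<M h. if i < ?g then u i else 0) = (\<Sum>i<?g. u i)" for u :: "nat \<Rightarrow> 'f"
      using M(1)[of h] by (intro sum.mono_neutral_cong_right) auto
    have "?\<psi> \<in> box (1 / real h) ?g"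
      by (rule boxI[of "{..<?g}"]) (auto simp: norm_mult norm_power norm_divide)
    moreover have "(\<Sum>i<M h. ?\<psi> i) = 0"
      unfolding sum sum_distrib_left[symmetric] sum_alternating by simp
    ultimately have "?\<psi> \<in> F h" unfolding F_def by blast
    moreover have "real h \<le> norm (\<Sum>i<M h. ?\<psi> i * (-1) ^ i)"
    proof -
      have "(\<Sum>i<M h. ?\<psi> i * (-1) ^ i) = (\<Sum>i<M h. if i < ?g then of_real (1 / real h) else 0)"
        by (intro sum.cong) (auto simp: power_mult_distrib[symmetric])
      also have "\<dots> = of_real (1 / real h * real ?g)" unfolding sum by simp
      also have "1 / real h * real ?g = 2 * real h" using H(2)[OF h] by (simp add: power2_eq_square)
      finally show ?thesis by (simp only: norm_of_real)
    qed
    ultimately show "\<exists>\<psi>\<in>F h. real h \<le> norm (\<Sum>i<M h. \<psi> i * (-1) ^ i)"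
      by (intro bexI[of _ ?\<psi>])
  next
    fix h \<phi> assume "\<phi> \<in> F h"
    then show "norm (\<Sum>i<M h. \<phi> i * 1) \<le> 1" by (simp add: F_def)
  qed (simp_all add: norm_power)
  ultimately show ?thesis using banach_space markushevich by blast
qed

text \<open>
  The functionals \<open>seg h r\<close> are the multiples by \<open>1/P\<close> of the sums of the first \<open>r\<close> coordinates; unlike a zero-sum
  condition they survive truncation. With \<open>M = h P\<close> the full one takes the value \<open>h\<close> on the constant
  block of length \<open>M\<close>. The two boxes dominate them on sets of at most \<open>P\<close> and of at least \<open>Q\<close> elements,
  where \<open>Q \<cdot> h/Q = M/P\<close> is the exact balance; on the block itself the second box contributes at most
  \<open>M h/Q = h\<^sup>2 P/Q \<le> 1\<close>.
\<close>

lemma quotient_gaps_schauder: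
  assumes mono: "strict_mono n" and pos: "\<And>k. 0 < n k" and gaps: "quotient_gaps n"
  shows "\<exists>(X :: (nat \<Rightarrow> 'f::{real_normed_field,euclidean_space}) set) N e f.
    banach_space_on scale_seq X N \<and> schauder_basis scale_seq X N e f \<and>
    UL_property scale_seq N e n \<and> \<not> unconditional_const_coeffs scale_seq N e"
proof -
  have "\<exists>p q. 2 * h \<le> p \<and> h\<^sup>2 * p \<le> q \<and> (\<forall>i. n i \<le> p \<or> q \<le> n i)" for h :: nat
  proof -
    obtain k where k: "2 * h \<le> k" "real (h\<^sup>2) \<le> real (n (Suc k)) / real (n k)"
      using frequently_large[OF gaps[unfolded quotient_gaps_def], of "2 * h" "real (h\<^sup>2)"] by blast
    have nk: "k \<le> n k" by (rule strict_mono_imp_increasing[OF mono])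
    have "real (h\<^sup>2 * n k) \<le> real (n (Suc k))" using k(2) pos[of k] by (simp add: le_divide_eq)
    then have gap: "h\<^sup>2 * n k \<le> n (Suc k)" by (simp only: of_nat_le_iff)
    have "n i \<le> n k \<or> n (Suc k) \<le> n i" for i
      using strict_mono_less_eq[OF mono, of i k] strict_mono_less_eq[OF mono, of "Suc k" i] by linarith
    then show ?thesis using k(1) nk gap by (intro exI[of _ "n k"] exI[of _ "n (Suc k)"]) auto
  qed
  then obtain P Q where PQ: "\<And>h. 2 * h \<le> P h" "\<And>h. h\<^sup>2 * P h \<le> Q h"
      "\<And>h i. n i \<le> P h \<or> Q h \<le> n i"
    by metis
  define M where "M h = h * P h" for h
  have M_ge: "2 * h\<^sup>2 \<le> M h" for h
    using mult_le_mono2[OF PQ(1)[of h], of h] by (simp add: M_def power2_eq_square mult_ac)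
  have grow: "h < M h" if "2 \<le> h" for h
  proof -
    have "h < 2 * h\<^sup>2" using that by (simp add: power2_eq_square)
    then show ?thesis using M_ge[of h] by linarith
  qed
  obtain H where H: "infinite H" "\<And>h. h \<in> H \<Longrightarrow> 2 \<le> h"
    "\<And>l h. l \<in> H \<Longrightarrow> h \<in> H \<Longrightarrow> l < h \<Longrightarrow> M l \<le> h"
    using sparse_set_exists[of M] grow by blast
  define seg :: "nat \<Rightarrow> nat \<Rightarrow> nat \<Rightarrow> 'f" where
    "seg h r = (\<lambda>i. if i < r then of_real (1 / real (P h)) else 0)" for h r
  define F :: "nat \<Rightarrow> (nat \<Rightarrow> 'f) set" where
    "F h = box (1 / real (P h)) (P h) \<union> box (real h / real (Q h)) (Q h) \<union> seg h ` {..M h}" for h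
  have P_ge: "2 * h \<le> P h" for h by (rule PQ(1))
  have ineqs: "0 < P h" "0 < Q h" "M h \<le> Q h" "real (M h) / real (P h) = real h"
      "real h / real (Q h) \<le> 1 / real h" "real h / real (Q h) * real (M h) \<le> 1"
    if "2 \<le> h" for h
  proof -
    show P: "0 < P h" using PQ(1)[of h] that by linarith
    have "h * 1 \<le> h * h" using that by (intro mult_le_mono2) linarith
    then have "h * P h \<le> h\<^sup>2 * P h" by (intro mult_le_mono1) (simp add: power2_eq_square)
    then show MQ: "M h \<le> Q h" using PQ(2)[of h] unfolding M_def by linarith
    have "0 < M h" using P that by (simp add: M_def)
    then show Q: "0 < Q h" using MQ by linarith
    show "real (M h) / real (P h) = real h" using P by (simp add: M_def)
    have "h\<^sup>2 * 1 \<le> h\<^sup>2 * P h" using P by (intro mult_le_mono2) linarith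
    then have "h\<^sup>2 \<le> Q h" using PQ(2)[of h] by linarith
    then have "real (h\<^sup>2) \<le> real (Q h)" by (simp only: of_nat_le_iff)
    then show "real h / real (Q h) \<le> 1 / real h"
      using Q that by (simp add: field_simps power2_eq_square)
    have "real (h\<^sup>2 * P h) \<le> real (Q h)" using PQ(2)[of h] by (simp only: of_nat_le_iff)
    then show "real h / real (Q h) * real (M h) \<le> 1"
      using Q by (simp add: M_def field_simps power2_eq_square)
  qed
  have F_cases: thesis
    if "\<phi> \<in> F h" "\<phi> \<in> box (1 / real (P h)) (P h) \<Longrightarrow> thesis"
      "\<phi> \<in> box (real h / real (Q h)) (Q h) \<Longrightarrow> thesis"
      "\<And>r. r \<le> M h \<Longrightarrow> \<phi> = seg h r \<Longrightarrow> thesis" for \<phi> h thesis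
    using that unfolding F_def by blast
  have seg_sum: "(\<Sum>i\<in>A. norm (seg h r i)) \<le> 1 / real (P h) * min (card A) (M h)"
    if "r \<le> M h" "finite A" for h r A
  proof -
    have "(\<Sum>i\<in>A. norm (seg h r i)) = (\<Sum>i\<in>A \<inter> {..<r}. 1 / real (P h))"
      using that(2) by (intro sum.mono_neutral_cong_right) (auto simp: seg_def norm_divide)
    also have "\<dots> = 1 / real (P h) * card (A \<inter> {..<r})" by simp
    also have "card (A \<inter> {..<r}) \<le> min (card A) (M h)"
      using card_mono[OF that(2), of "A \<inter> {..<r}"] card_mono[of "{..<r}" "A \<inter> {..<r}"] that(1) by simp
    then have "1 / real (P h) * card (A \<inter> {..<r}) \<le> 1 / real (P h) * min (card A) (M h)"
      by (intro mult_left_mono) auto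
    finally show ?thesis .
  qed
  have box1_sum: "1 / real (P h) * min (card A) (P h) \<le> 1" if "2 \<le> h" for h and A :: "nat set"
    using ineqs(1)[OF that] by (simp add: divide_le_eq)
  interpret sparse_family H M F
  proof (rule sparse_family.intro[OF H(1-3) M_ge])
    fix h \<phi> i assume h: "h \<in> H" and \<phi>: "\<phi> \<in> F h"
    note iq = ineqs[OF H(2)[OF h]]
    have Ph: "1 / real (P h) \<le> 1 / real h"
      using P_ge[of h] H(2)[OF h] by (intro divide_left_mono) auto
    show "finite {i. \<phi> i \<noteq> 0}"
      using \<phi> by (rule F_cases) (auto simp: box_def seg_def)
    show "norm (\<phi> i) \<le> 1 / real h"
      using \<phi>
    proof (rule F_cases)
      fix r assume "\<phi> = seg h r"
      then show ?thesis using Ph by (simp add: seg_def norm_divide)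
    next
      assume "\<phi> \<in> box (1 / real (P h)) (P h)"
      then have "norm (\<phi> i) \<le> 1 / real (P h)" by (simp add: box_def)
      then show ?thesis using Ph by linarith
    next
      assume "\<phi> \<in> box (real h / real (Q h)) (Q h)"
      then have "norm (\<phi> i) \<le> real h / real (Q h)" by (simp add: box_def)
      then show ?thesis using iq(5) by linarith
    qed
  next
    fix h \<phi> and A :: "nat set" assume h: "h \<in> H" and \<phi>: "\<phi> \<in> F h" and A: "finite A"
    note h2 = H(2)[OF h] note iq = ineqs[OF h2]
    show "(\<Sum>i\<in>A. norm (\<phi> i)) \<le> 2 * real h"
      using \<phi>
    proof (rule F_cases)
      fix r assume r: "r \<le> M h" "\<phi> = seg h r"
      have "1 / real (P h) * min (card A) (M h) \<le> 1 / real (P h) * real (M h)"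
        by (intro mult_left_mono) auto
      then show ?thesis using seg_sum[OF r(1) A] iq(4) unfolding r(2) by simp
    next
      assume "\<phi> \<in> box (1 / real (P h)) (P h)"
      then show ?thesis using sum_box_le[OF _ A] box1_sum[OF h2, of A] h2 by fastforce
    next
      assume b: "\<phi> \<in> box (real h / real (Q h)) (Q h)"
      have "real h / real (Q h) * min (card A) (Q h) \<le> real h / real (Q h) * real (Q h)"
        by (intro mult_left_mono) auto
      also have "\<dots> = real h" using iq(2) by simp
      finally show ?thesis using sum_box_le[OF b A] by linarith
    qed
  qed
  have "UL_property scale_seq N unit_seq n"
  proof (rule UL_property_if_families[OF pos])
    fix A :: "nat set" and a \<phi> :: "nat \<Rightarrow> 'f" and \<mu> :: real and h
    assume h: "h \<in> H" and A: "finite A" "card A \<in> range n" and \<phi>: "\<phi> \<in> F h"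
      and \<mu>: "0 \<le> \<mu>" "\<And>i. i \<in> A \<Longrightarrow> \<mu> \<le> norm (a i)"
    note h2 = H(2)[OF h] note iq = ineqs[OF h2]
    have attain: "\<exists>\<psi>\<in>F h. \<mu> * (\<Sum>i\<in>A. norm (\<phi> i)) \<le> 2 * norm (\<Sum>i\<in>A. \<psi> i * a i)"
      if sub: "box c s \<subseteq> F h" and c: "0 \<le> c" and le: "(\<Sum>i\<in>A. norm (\<phi> i)) \<le> c * min (card A) s"
      for c s
    proof -
      obtain \<psi> where \<psi>: "\<psi> \<in> box c s" "\<mu> * (c * min (card A) s) \<le> norm (\<Sum>i\<in>A. \<psi> i * a i)"
        using box_attains[OF A(1) c \<mu>] .
      have "\<mu> * (\<Sum>i\<in>A. norm (\<phi> i)) \<le> \<mu> * (c * min (card A) s)"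
        by (rule mult_left_mono[OF le \<mu>(1)])
      then have "\<mu> * (\<Sum>i\<in>A. norm (\<phi> i)) \<le> 2 * norm (\<Sum>i\<in>A. \<psi> i * a i)"
        using \<psi>(2) norm_ge_zero[of "\<Sum>i\<in>A. \<psi> i * a i"] by linarith
      then show ?thesis using \<psi>(1) sub by blast
    qed
    have sub: "box (1 / real (P h)) (P h) \<subseteq> F h" "box (real h / real (Q h)) (Q h) \<subseteq> F h"
      unfolding F_def by auto
    have c: "0 \<le> 1 / real (P h)" "0 \<le> real h / real (Q h)" by auto
    show "\<exists>\<psi>\<in>F h. \<mu> * (\<Sum>i\<in>A. norm (\<phi> i)) \<le> 2 * norm (\<Sum>i\<in>A. \<psi> i * a i)"
      using \<phi>
    proof (rule F_cases)
      assume "\<phi> \<in> box (1 / real (P h)) (P h)"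
      then show ?thesis by (intro attain[OF sub(1) c(1)] sum_box_le A(1))
    next
      assume "\<phi> \<in> box (real h / real (Q h)) (Q h)"
      then show ?thesis by (intro attain[OF sub(2) c(2)] sum_box_le A(1))
    next
      fix r assume r: "r \<le> M h" "\<phi> = seg h r"
      note seg_le = seg_sum[OF r(1) A(1)]
      obtain i where i: "card A = n i" using A(2) by blast
      consider "card A \<le> P h" | "Q h \<le> card A" using PQ(3)[of i h] unfolding i by blast
      then show ?thesis
      proof cases
        case 1
        have "1 / real (P h) * min (card A) (M h) \<le> 1 / real (P h) * min (card A) (P h)"
          using 1 by (intro mult_left_mono) auto
        then show ?thesis using seg_le unfolding r(2)[symmetric] by (intro attain[OF sub(1) c(1)]) linarith
      next
        case 2
        have "1 / real (P h) * min (card A) (M h) \<le> 1 / real (P h) * real (M h)"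
          by (intro mult_left_mono) auto
        also have "\<dots> = real h" using iq(4) by simp
        also have "\<dots> = real h / real (Q h) * min (card A) (Q h)" using 2 iq(2) by simp
        finally show ?thesis using seg_le unfolding r(2)[symmetric] by (intro attain[OF sub(2) c(2)]) linarith
      qed
    qed
  qed
  moreover have "\<not> unconditional_const_coeffs scale_seq N unit_seq"
  proof (rule not_unconditional[of "\<lambda>_. 1" "\<lambda>i. (-1) ^ i"])
    fix h assume h: "h \<in> H"
    note iq = ineqs[OF H(2)[OF h]]
    have "(\<Sum>i<M h. seg h (M h) i * 1) = (\<Sum>i<M h. of_real (1 / real (P h)))"
      by (intro sum.cong) (auto simp: seg_def)
    also have "\<dots> = of_real (real (M h) / real (P h))" by simp
    finally have "norm (\<Sum>i<M h. seg h (M h) i * 1) = real h"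
      unfolding iq(4) by (simp only: norm_of_real)
    then show "\<exists>\<psi>\<in>F h. real h \<le> norm (\<Sum>i<M h. \<psi> i * 1)"
      unfolding F_def by (intro bexI[of _ "seg h (M h)"]) auto
  next
    fix h and \<phi> :: "nat \<Rightarrow> 'f" assume h: "h \<in> H" and \<phi>: "\<phi> \<in> F h"
    note h2 = H(2)[OF h] note iq = ineqs[OF h2]
    have le_sum: "norm (\<Sum>i<M h. \<phi> i * (-1) ^ i) \<le> (\<Sum>i<M h. norm (\<phi> i))"
      by (rule sum_norm_le) (simp add: norm_mult norm_power)
    show "norm (\<Sum>i<M h. \<phi> i * (-1) ^ i) \<le> 1"
      using \<phi>
    proof (rule F_cases)
      assume b: "\<phi> \<in> box (1 / real (P h)) (P h)"
      then show ?thesis using le_sum sum_box_le[OF b finite_lessThan, of "M h"] box1_sum[OF h2, of "{..<M h}"]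
        by (meson order_trans)
    next
      assume b: "\<phi> \<in> box (real h / real (Q h)) (Q h)"
      have "real h / real (Q h) * min (card {..<M h}) (Q h) \<le> real h / real (Q h) * real (M h)"
        by (intro mult_left_mono) auto
      then show ?thesis using le_sum sum_box_le[OF b finite_lessThan, of "M h"] iq(6) by linarith
    next
      fix r assume r: "r \<le> M h" "\<phi> = seg h r"
      have "(\<Sum>i<M h. \<phi> i * (-1) ^ i) = (\<Sum>i<r. of_real (1 / real (P h)) * (-1) ^ i)"
        unfolding r(2) using r(1) by (intro sum.mono_neutral_cong_right) (auto simp: seg_def)
      also have "\<dots> = of_real (1 / real (P h)) * (if even r then 0 else 1)"
        unfolding sum_distrib_left[symmetric] sum_alternating by (rule refl)
      finally show ?thesis using iq(1) by (simp add: norm_divide)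
    qed
  qed (simp_all add: norm_power)
  moreover have "schauder_basis scale_seq X N unit_seq (\<lambda>i x. x i)"
  proof (rule schauder_if_truncation_closed)
    fix \<phi> :: "nat \<Rightarrow> 'f" and m :: nat assume \<phi>: "\<phi> \<in> with_units H F"
    let ?t = "\<lambda>i. if i < m then \<phi> i else 0"
    have box_trunc: "?t \<in> box c s" if b: "\<phi> \<in> box c s" for c s
    proof (rule boxI[of "{i. \<phi> i \<noteq> 0}"])
      show "norm (?t i) \<le> c" for i
      proof -
        have "norm (\<phi> i) \<le> c" using b by (simp add: box_def)
        then show ?thesis using norm_ge_zero[of "\<phi> i"] by (simp del: norm_ge_zero)
      qed
    qed (use b in \<open>auto simp: box_def\<close>)
    from \<phi> consider k where "\<phi> = unit_seq k" | h where "h \<in> H" "\<phi> \<in> F h"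
      unfolding with_units_def by blast
    then show "?t \<in> with_units H F"
    proof cases
      case 1
      show ?thesis
      proof (cases "k < m")
        case True
        then have "?t = unit_seq k" unfolding 1 by (auto simp: unit_seq_def fun_eq_iff)
        then show ?thesis unfolding with_units_def by blast
      next
        case False
        obtain h where h: "h \<in> H" using H(1) by (metis ex_in_conv finite.emptyI)
        have "?t = seg h 0" using False unfolding 1 by (auto simp: unit_seq_def seg_def fun_eq_iff)
        then show ?thesis using h unfolding with_units_def F_def by blast
      qed
    next
      case 2
      have "?t \<in> F h"
        using 2(2)
      proof (rule F_cases)
        fix r assume r: "r \<le> M h" "\<phi> = seg h r"
        have "?t = seg h (min m r)" unfolding r(2) by (auto simp: seg_def fun_eq_iff)
        moreover have "min m r \<in> {..M h}" using r(1) by simp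
        ultimately show ?thesis unfolding F_def by blast
      qed (use box_trunc in \<open>auto simp: F_def\<close>)
      then show ?thesis using 2(1) unfolding with_units_def by blast
    qed
  qed
  ultimately show ?thesis using banach_space by blast
qed

theorem proposition2p5:
  fixes n :: "nat \<Rightarrow> nat"
  assumes "strict_mono n" and "\<forall>k. 0 < n k"
  shows "(additive_gaps n \<longrightarrow>
           (\<exists>(X :: (nat \<Rightarrow> real) set) N e f.
             banach_space_on scale_seq X N \<and>
             markushevich_basis scale_seq X N e f \<and>
             UL_property scale_seq N e n \<and>
             \<not> unconditional_const_coeffs scale_seq N e) \<and>
           (\<exists>(X :: (nat \<Rightarrow> complex) set) N e f.
             banach_space_on scale_seq X N \<and>
             markushevich_basis scale_seq X N e f \<and>
             UL_property scale_seq N e n \<and>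
             \<not> unconditional_const_coeffs scale_seq N e)) \<and>
         (quotient_gaps n \<longrightarrow>
           (\<exists>(X :: (nat \<Rightarrow> real) set) N e f.
             banach_space_on scale_seq X N \<and>
             schauder_basis scale_seq X N e f \<and>
             UL_property scale_seq N e n \<and>
             \<not> unconditional_const_coeffs scale_seq N e) \<and>
           (\<exists>(X :: (nat \<Rightarrow> complex) set) N e f.
             banach_space_on scale_seq X N \<and>
             schauder_basis scale_seq X N e f \<and>
             UL_property scale_seq N e n \<and>
             \<not> unconditional_const_coeffs scale_seq N e))"
proof (intro conjI impI)
  have pos: "\<And>k. 0 < n k" using assms(2) by blast
  note add = additive_gaps_markushevich[OF assms(1) pos]
  note quot = quotient_gaps_schauder[OF assms(1) pos]
  show "\<exists>(X :: (nat \<Rightarrow> real) set) N e f. banach_space_on scale_seq X N \<and>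
      markushevich_basis scale_seq X N e f \<and> UL_property scale_seq N e n \<and>
      \<not> unconditional_const_coeffs scale_seq N e"
    "\<exists>(X :: (nat \<Rightarrow> complex) set) N e f. banach_space_on scale_seq X N \<and>
      markushevich_basis scale_seq X N e f \<and> UL_property scale_seq N e n \<and>
      \<not> unconditional_const_coeffs scale_seq N e"
    if "additive_gaps n"
    using that by (rule add)+
  show "\<exists>(X :: (nat \<Rightarrow> real) set) N e f. banach_space_on scale_seq X N \<and>
      schauder_basis scale_seq X N e f \<and> UL_property scale_seq N e n \<and>
      \<not> unconditional_const_coeffs scale_seq N e"
    "\<exists>(X :: (nat \<Rightarrow> complex) set) N e f. banach_space_on scale_seq X N \<and>
      schauder_basis scale_seq X N e f \<and> UL_property scale_seq N e n \<and>
      \<not> unconditional_const_coeffs scale_seq N e"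
    if "quotient_gaps n"
    using that by (rule quot)+
qed

end
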